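(* Let $a>0$, $b\in(1,3)$ with $b\neq 2$, put $d=1-b/2$, let $x_t\sim CSA(a,b)$, and let $z_t=(1-L)^dx_t$ be the $d$-fractional difference of the series. Let $$\gamma_z(k)=\frac{\gamma^*(k)}{B(a,b)}\left[B(a,b-1)\left(F_1(k)-1\right)+B\left(a+\tfrac12,b-1\right)F_2(k)\right],\qquad k=0,1,$$ with $$\gamma^*(k)=\sigma_\epsilon^2\,\frac{\Gamma(1+2d)}{\Gamma(-d)\Gamma(1+d)}\,\frac{\Gamma(-d-k)}{\Gamma(1+d-k)},$$ $$\begin{aligned}F_1(k)={}&F\left[\left\{1,a,\tfrac{1-d+k}{2},\tfrac{-d+k}{2}\right\},\left\{a+b-1,\tfrac{2+d+k}{2},\tfrac{1+d+k}{2}\right\},1\right]\\&+F\left[\left\{1,a,\tfrac{1-d-k}{2},\tfrac{-d-k}{2}\right\},\left\{a+b-1,\tfrac{2+d-k}{2},\tfrac{1+d-k}{2}\right\},1\right],\end{aligned}$$ $$\begin{aligned}F_2(k)={}&\tfrac{-d+k}{1+d+k}\,F\left[\left\{1,a+\tfrac12,\tfrac{1-d+k}{2},\tfrac{2-d+k}{2}\right\},\left\{a+b-\tfrac12,\tfrac{2+d+k}{2},\tfrac{3+d+k}{2}\right\},1\right]\\&+\tfrac{-d-k}{1+d-k}\,F\left[\left\{1,a+\tfrac12,\tfrac{1-d-k}{2},\tfrac{2-d-k}{2}\right\},\left\{a+b-\tfrac12,\tfrac{2+d-k}{2},\tfrac{3+d-k}{2}\right\},1\right].\end{aligned}$$ Then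 the one-step ahead forecast error variance of the $I(d)$ model, $\zeta_{I(d)}=\operatorname{Var}(z_t)$, is given by $$\zeta_{I(d)}=\gamma_z(0).$$ Furthermore, estimate an $ARFIMA(1,d,0)$ model by fitting an $AR(1)$ model to $z_t$, i.e. let $\alpha_I$ minimize $\operatorname{Var}(z_t-\alpha z_{t-1})$ over $\alpha\in\mathbb{R}$, and let $\zeta_{ARFIMA(1,d,0)}=\operatorname{Var}(z_t-\alpha_Iz_{t-1})$ be its one-step ahead forecast error variance. Then $$\alpha_I=\frac{\gamma_z(1)}{\gamma_z(0)},\qquad \zeta_{ARFIMA(1,d,0)}=\frac{\gamma_z(0)^2-\gamma_z(1)^2}{\gamma_z(0)}.$$
   Context: $B(\cdot,\cdot)$ is the Beta function, $\Gamma$ the Gamma function, $L$ the lag operator, and $F[\{a_1,\dots,a_4\},\{b_1,b_2,b_3\},w]=\sum_{m\ge0}\frac{(a_1)_m(a_2)_m(a_3)_m(a_4)_m}{(b_1)_m(b_2)_m(b_3)_m}\frac{w^m}{m!}$ is the generalized hypergeometric function, with $(c)_m=c(c+1)\cdots(c+m-1)$ and $(c)_0=1$. The fractional difference operator is defined by the binomial expansion $(1-L)^d=\sum_{j\ge0}\frac{\Gamma(j-d)}{\Gamma(-d)\Gamma(j+1)}L^j$ (the series applied to $x_t$ is understood in mean square). Cross-sectional aggregation: $x_t\sim CSA(a,b)$ denotes the stationary zero-mean process obtained (as $N\to\infty$) from $x_t=N^{-1/2}\sum_{i=1}^N x_{i,t}$, where $x_{i,t}=\alpha_i x_{i,t-1}+\epsilon_{i,t}$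 are stationary AR(1) series, the $\epsilon_{i,t}$ are i.i.d. with mean zero and variance $\sigma_\epsilon^2>0$, and the $\alpha_i\in(0,1)$ are i.i.d., independent of the errors, with $\alpha_i^2$ drawn from the Beta distribution with density $\frac{1}{B(a,b)}u^{a-1}(1-u)^{b-1}$ on $(0,1)$. For $b>1$ its autocovariance function is $E[x_tx_{t+k}]=\sigma_\epsilon^2\,B(a+|k|/2,b-1)/B(a,b)$, $k\in\mathbb{Z}$. The one-step ahead forecast error of the $I(d)$ model is $z_t=(1-L)^dx_t$, and that of the $ARFIMA(1,d,0)$ model is $z_t-\alpha_Iz_{t-1}$. *)

theory Defs
  imports "HOL-Probability.Probability"
begin

definition strictly_stationary :: "'a measure \<Rightarrow> (int \<Rightarrow> 'a \<Rightarrow> real) \<Rightarrow> bool" where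
  "strictly_stationary P X \<longleftrightarrow>
     (\<forall>t. X t \<in> borel_measurable P) \<and>
     (\<forall>h. distr P (PiM UNIV (\<lambda>_. borel)) (\<lambda>\<omega> t. X (t + h) \<omega>)
        = distr P (PiM UNIV (\<lambda>_. borel)) (\<lambda>\<omega> t. X t \<omega>))"

text \<open>
  A panel of random-coefficient AR(1) series: \<open>y i t\<close> is the value at time \<open>t\<close> of the
  \<open>i\<close>-th series, with coefficient \<open>\<alpha> i\<close>, innovations \<open>\<epsilon> i t\<close> and innovation variance
  \<open>\<sigma>\<^sup>2\<close>. Joint independence of all the \<open>\<alpha> i\<close> and \<open>\<epsilon> i t\<close> says at once that each of the two
  families is independent and that they are independent of each other. The \<open>\<alpha> i\<close> are
  identically distributed because they are positive and their squares share a Beta law.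
\<close>

definition ar1_panel ::
  "'a measure \<Rightarrow> (nat \<Rightarrow> 'a \<Rightarrow> real) \<Rightarrow> (nat \<Rightarrow> int \<Rightarrow> 'a \<Rightarrow> real) \<Rightarrow>
   (nat \<Rightarrow> int \<Rightarrow> 'a \<Rightarrow> real) \<Rightarrow> real \<Rightarrow> real \<Rightarrow> real \<Rightarrow> bool" where
  "ar1_panel P \<alpha> \<epsilon> y a b \<sigma> \<longleftrightarrow>
     prob_space P \<and>
     prob_space.indep_vars P (\<lambda>_. borel)
       (\<lambda>k. case k of Inl i \<Rightarrow> \<alpha> i | Inr (i, t) \<Rightarrow> \<epsilon> i t) UNIV \<and>
     (\<forall>i. AE \<omega> in P. 0 < \<alpha> i \<omega> \<and> \<alpha> i \<omega> < 1) \<and>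
     (\<forall>i. distributed P lborel (\<lambda>\<omega>. (\<alpha> i \<omega>)\<^sup>2)
        (\<lambda>u. ennreal (indicator {0<..<1} u *
               (1 / Beta a b * u powr (a - 1) * (1 - u) powr (b - 1))))) \<and>
     (\<forall>i t. distr P borel (\<epsilon> i t) = distr P borel (\<epsilon> 0 0)) \<and>
     (\<forall>i t. integrable P (\<lambda>\<omega>. (\<epsilon> i t \<omega>)\<^sup>2)) \<and>
     (\<forall>i t. prob_space.expectation P (\<epsilon> i t) = 0) \<and>
     (\<forall>i t. prob_space.variance P (\<epsilon> i t) = \<sigma>\<^sup>2) \<and>
     (\<forall>i. strictly_stationary P (y i)) \<and>
     (\<forall>i t. AE \<omega> in P. y i t \<omega> = \<alpha> i \<omega> * y i (t - 1) \<omega> + \<epsilon> i t \<omega>)"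

definition panel_aggregate ::
  "(nat \<Rightarrow> int \<Rightarrow> 'a \<Rightarrow> real) \<Rightarrow> nat \<Rightarrow> int \<Rightarrow> 'a \<Rightarrow> real" where
  "panel_aggregate y N t \<omega> = (\<Sum>i<N. y i t \<omega>) / sqrt (real N)"

text \<open>
  Convergence in distribution of all finite-dimensional marginals. The type
  \<^typ>\<open>int \<Rightarrow> real\<close> carries the product topology, so composing the continuous \<open>f\<close> with the
  truncation to the finite set \<open>T\<close> gives exactly the continuous functions on \<open>\<real>\<^sup>T\<close>.
  The two processes may live on different probability spaces.
\<close>

definition fdd_converges ::
  "'a measure \<Rightarrow> (nat \<Rightarrow> int \<Rightarrow> 'a \<Rightarrow> real) \<Rightarrow> 'b measure \<Rightarrow> (int \<Rightarrow> 'b \<Rightarrow> real) \<Rightarrow> bool" where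
  "fdd_converges P Y M X \<longleftrightarrow>
     (\<forall>T. \<forall>f :: (int \<Rightarrow> real) \<Rightarrow> real.
        finite T \<longrightarrow> continuous_on UNIV f \<longrightarrow> bounded (range f) \<longrightarrow>
        (\<lambda>N. \<integral>\<omega>. f (\<lambda>t. if t \<in> T then Y N t \<omega> else 0) \<partial>P)
          \<longlonglongrightarrow> (\<integral>\<omega>. f (\<lambda>t. if t \<in> T then X t \<omega> else 0) \<partial>M))"

text \<open>
  \<open>x\<close> is a CSA process on \<open>M\<close>, arising as the large-\<open>N\<close> limit of the normalised aggregates of
  the panel \<open>y\<close> on \<open>P\<close>. That \<open>x\<close> is stationary, has mean zero and, for \<open>b > 1\<close>, has the
  autocovariances \<open>\<sigma>\<^sup>2 B(a + \<bar>k\<bar>/2, b - 1) / B(a, b)\<close> is a consequence, not a requirement.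
\<close>

definition CSA ::
  "'a measure \<Rightarrow> (nat \<Rightarrow> 'a \<Rightarrow> real) \<Rightarrow> (nat \<Rightarrow> int \<Rightarrow> 'a \<Rightarrow> real) \<Rightarrow>
   (nat \<Rightarrow> int \<Rightarrow> 'a \<Rightarrow> real) \<Rightarrow> real \<Rightarrow> real \<Rightarrow> real \<Rightarrow>
   'b measure \<Rightarrow> (int \<Rightarrow> 'b \<Rightarrow> real) \<Rightarrow> bool" where
  "CSA P \<alpha> \<epsilon> y a b \<sigma> M x \<longleftrightarrow>
     ar1_panel P \<alpha> \<epsilon> y a b \<sigma> \<and>
     prob_space M \<and> (\<forall>t. x t \<in> borel_measurable M) \<and>
     fdd_converges P (panel_aggregate y) M x"

definition mean_square_limit ::
  "'a measure \<Rightarrow> (nat \<Rightarrow> 'a \<Rightarrow> real) \<Rightarrow> ('a \<Rightarrow> real) \<Rightarrow> bool" where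
  "mean_square_limit M S Z \<longleftrightarrow>
     (\<forall>n. S n \<in> borel_measurable M \<and> integrable M (\<lambda>\<omega>. (S n \<omega>)\<^sup>2)) \<and>
     Z \<in> borel_measurable M \<and> integrable M (\<lambda>\<omega>. (Z \<omega>)\<^sup>2) \<and>
     (\<lambda>n. \<integral>\<omega>. (S n \<omega> - Z \<omega>)\<^sup>2 \<partial>M) \<longlonglongrightarrow> 0"

definition frac_diff_coeff :: "real \<Rightarrow> nat \<Rightarrow> real" where
  "frac_diff_coeff d j = Gamma (real j - d) / (Gamma (- d) * Gamma (real j + 1))"

text \<open>\<open>z = (1 - L)\<^sup>d x\<close>; mean-square limits are unique only up to null sets, hence a relation.\<close>

definition is_frac_diff ::
  "'a measure \<Rightarrow> real \<Rightarrow> (int \<Rightarrow> 'a \<Rightarrow> real) \<Rightarrow> (int \<Rightarrow> 'a \<Rightarrow> real) \<Rightarrow> bool" where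
  "is_frac_diff M d x z \<longleftrightarrow>
     (\<forall>t. mean_square_limit M
        (\<lambda>n \<omega>. \<Sum>j<n. frac_diff_coeff d j * x (t - int j) \<omega>) (z t))"

definition hypergeom_F :: "real list \<Rightarrow> real list \<Rightarrow> real \<Rightarrow> real" where
  "hypergeom_F as bs w =
     (\<Sum>m. (\<Prod>c\<leftarrow>as. pochhammer c m) / (\<Prod>c\<leftarrow>bs. pochhammer c m) * (w ^ m / fact m))"

definition gamma_star :: "real \<Rightarrow> real \<Rightarrow> real \<Rightarrow> real" where
  "gamma_star \<sigma> d k =
     \<sigma>\<^sup>2 * (Gamma (1 + 2 * d) / (Gamma (- d) * Gamma (1 + d)))
       * (Gamma (- d - k) / Gamma (1 + d - k))"

definition F1 :: "real \<Rightarrow> real \<Rightarrow> real \<Rightarrow> real \<Rightarrow> real" where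
  "F1 a b d k =
     hypergeom_F [1, a, (1 - d + k) / 2, (- d + k) / 2]
                 [a + b - 1, (2 + d + k) / 2, (1 + d + k) / 2] 1
   + hypergeom_F [1, a, (1 - d - k) / 2, (- d - k) / 2]
                 [a + b - 1, (2 + d - k) / 2, (1 + d - k) / 2] 1"

definition F2 :: "real \<Rightarrow> real \<Rightarrow> real \<Rightarrow> real \<Rightarrow> real" where
  "F2 a b d k =
     (- d + k) / (1 + d + k) *
       hypergeom_F [1, a + 1/2, (1 - d + k) / 2, (2 - d + k) / 2]
                   [a + b - 1/2, (2 + d + k) / 2, (3 + d + k) / 2] 1
   + (- d - k) / (1 + d - k) *
       hypergeom_F [1, a + 1/2, (1 - d - k) / 2, (2 - d - k) / 2]
                   [a + b - 1/2, (2 + d - k) / 2, (3 + d - k) / 2] 1"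

definition gamma_z :: "real \<Rightarrow> real \<Rightarrow> real \<Rightarrow> real \<Rightarrow> real \<Rightarrow> real" where
  "gamma_z a b \<sigma> d k =
     gamma_star \<sigma> d k / Beta a b *
       (Beta a (b - 1) * (F1 a b d k - 1) + Beta (a + 1/2) (b - 1) * F2 a b d k)"

end

theory Submission
  imports Defs "HOL-Real_Asymp.Real_Asymp"
begin

text \<open>
  Write \<open>\<gamma>\<close> for the autocovariance function of \<open>x\<close> and \<open>\<pi>\<^sub>j\<close> for the weights of the filter
  \<open>(1 - L)\<^sup>d\<close>. The covariance of \<open>z\<^sub>t\<close> and \<open>z\<^sub>t\<^sub>-\<^sub>k\<close> is the limit of the quadratic forms
  \<open>\<Sum>i,j<n. \<pi>\<^sub>i \<pi>\<^sub>j \<gamma>(k + j - i)\<close>, and collecting the terms with equal \<open>j - i\<close> turns the limit into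
  \<open>\<Sum>h\<in>\<int>. \<gamma>(h) r(h - k)\<close>, where \<open>r\<close> is the autocorrelation sequence of the weights. Gauss's summation
  theorem for the hypergeometric series at \<open>1\<close> gives
  \<open>r(h) = C \<Gamma>(h - d) / \<Gamma>(1 + d + h)\<close>, and \<open>\<gamma>(h)\<close> is a constant times \<open>B(a + h/2, b - 1)\<close>. Along
  the even lags, and along the odd lags, both factors are quotients of Pochhammer symbols, so the two
  parities contribute the hypergeometric series in \<open>F1\<close> and in \<open>F2\<close> (\<open>csa_frac_autocov_suminf\<close>,
  \<open>gamma_z_eq\<close>, \<open>toeplitz_limit\<close>). The rearrangement needs absolute convergence.
  Here \<open>d = 1 - b/2\<close> makes \<open>\<gamma>(h)\<close> of order \<open>h powr (2 * d - 1)\<close> while \<open>r(h)\<close> is of order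
  \<open>h powr (- 2 * d - 1)\<close>; the product is of order \<open>h powr (- 2)\<close> for either sign of \<open>d\<close>
  (\<open>domination\<close>).

  The autocovariances have to be extracted from the definition of \<open>x\<close> as a limit in distribution.
  Each stationary series of the panel almost surely equals \<open>\<Sum>j. \<alpha>\<^sup>j \<epsilon>\<^sub>t\<^sub>-\<^sub>j\<close>
  (\<open>y_eq_solution\<close>), so the series are independent and identically distributed over the panel, with
  covariance \<open>\<sigma>\<^sup>2 E(\<alpha>\<^sup>h / (1 - \<alpha>\<^sup>2))\<close>. Second moments need not survive a limit in distribution, but the central limit
  theorem shows that sums of the \<open>x\<^sub>t\<close> over finite sets are normal with the variance computed
  from the panel (\<open>sum_x_normal\<close>), and polarisation then gives all the covariances.

  Finally \<open>Var(z\<^sub>t - c z\<^sub>t\<^sub>-\<^sub>1)\<close> is a quadratic polynomial in \<open>c\<close>. It has exactly one minimiser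
  because \<open>gamma_z a b \<sigma> d 0\<close> is strictly positive (\<open>gamma_z_0_pos\<close>).
\<close>

section \<open>Growth of Gamma quotients\<close>

text \<open>
  This is the limit formula behind \<open>rGamma_series\<close>. The base \<open>n + 1\<close> in place of \<open>n\<close> keeps the
  normaliser positive at \<open>n = 0\<close>, so that the bounds derived from it hold for every \<open>n\<close>.
\<close>

lemma pochhammer_asymp:
  "(\<lambda>n. pochhammer z n / (fact n * (real n + 1) powr (z - 1))) \<longlonglongrightarrow> rGamma (z :: real)"
proof (rule filterlim_sequentially_Suc[THEN iffD1])
  have "(\<lambda>n. real n powr z / ((real n + 1) * (real n + 2) powr (z - 1))) \<longlonglongrightarrow> 1"
    by real_asymp
  with rGamma_series_LIMSEQ[of z]
  have "(\<lambda>n. rGamma_series z n * (real n powr z / ((real n + 1) * (real n + 2) powr (z - 1))))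
           \<longlonglongrightarrow> rGamma z * 1"
    by (rule tendsto_mult)
  moreover have "\<forall>\<^sub>F n in sequentially.
      rGamma_series z n * (real n powr z / ((real n + 1) * (real n + 2) powr (z - 1)))
      = pochhammer z (Suc n) / (fact (Suc n) * (real (Suc n) + 1) powr (z - 1))"
    using eventually_gt_at_top[of 0]
  proof eventually_elim
    case (elim n)
    have "exp (z * ln (real n)) = real n powr z"
      using elim by (simp add: powr_def)
    moreover have "real n powr z > 0"
      using elim by simp
    ultimately show ?case
      using elim by (simp add: rGamma_series_def field_simps)
  qed
  ultimately show "(\<lambda>n. pochhammer z (Suc n) / (fact (Suc n) * (real (Suc n) + 1) powr (z - 1)))
      \<longlonglongrightarrow> rGamma z"
    using tendsto_cong by fastforce
qed

lemma convergent_imp_bounded_by: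
  fixes f :: "nat \<Rightarrow> real"
  assumes "f \<longlonglongrightarrow> L"
  obtains K where "K > 0" "\<And>n. \<bar>f n\<bar> \<le> K"
proof -
  have "Bseq f"
    using assms convergentI convergent_imp_Bseq by blast
  then show ?thesis
    using that by (auto simp: Bseq_def)
qed

lemma pochhammer_le:
  fixes z :: real
  obtains K where "K > 0" "\<And>n. \<bar>pochhammer z n\<bar> \<le> K * (fact n * (real n + 1) powr (z - 1))"
proof -
  obtain K where K: "K > 0"
      "\<And>n. \<bar>pochhammer z n / (fact n * (real n + 1) powr (z - 1))\<bar> \<le> K"
    using convergent_imp_bounded_by[OF pochhammer_asymp] by metis
  have "\<bar>pochhammer z n\<bar> \<le> K * (fact n * (real n + 1) powr (z - 1))" for n
    using K(2)[of n] by (simp add: abs_mult field_simps)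
  with K(1) show ?thesis using that by blast
qed

lemma pochhammer_quotient_asymp:
  fixes z w :: real
  assumes "w \<notin> \<int>\<^sub>\<le>\<^sub>0"
  shows "(\<lambda>n. pochhammer z n / pochhammer w n / (real n + 1) powr (z - w))
           \<longlonglongrightarrow> rGamma z * Gamma w"
proof -
  have "(\<lambda>n. (pochhammer z n / (fact n * (real n + 1) powr (z - 1))) /
             (pochhammer w n / (fact n * (real n + 1) powr (w - 1)))) \<longlonglongrightarrow> rGamma z / rGamma w"
    using assms by (intro tendsto_divide pochhammer_asymp) (simp add: rGamma_eq_zero_iff)
  moreover have "(pochhammer z n / (fact n * (real n + 1) powr (z - 1))) /
             (pochhammer w n / (fact n * (real n + 1) powr (w - 1)))
      = pochhammer z n / pochhammer w n / (real n + 1) powr (z - w)" for n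
  proof -
    have "(real n + 1) powr (z - 1) = (real n + 1) powr (w - 1) * (real n + 1) powr (z - w)"
      by (simp flip: powr_add)
    then show ?thesis by (simp add: field_simps)
  qed
  moreover have "rGamma z / rGamma w = rGamma z * Gamma w"
    by (simp add: Gamma_def divide_inverse)
  ultimately show ?thesis by simp
qed

lemma pochhammer_quotient_le:
  fixes z w :: real
  assumes "w \<notin> \<int>\<^sub>\<le>\<^sub>0"
  obtains K where "K > 0"
    "\<And>n. \<bar>pochhammer z n / pochhammer w n\<bar> \<le> K * (real n + 1) powr (z - w)"
proof -
  obtain K where K: "K > 0"
      "\<And>n. \<bar>pochhammer z n / pochhammer w n / (real n + 1) powr (z - w)\<bar> \<le> K"
    using convergent_imp_bounded_by[OF pochhammer_quotient_asymp[OF assms]] by metis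
  have "\<bar>pochhammer z n / pochhammer w n\<bar> \<le> K * (real n + 1) powr (z - w)" for n
    using K(2)[of n] by (simp add: abs_mult divide_divide_eq_left[symmetric] pos_divide_le_eq
        del: divide_divide_eq_left)
  with K(1) show ?thesis using that by blast
qed

lemma summable_Suc_powr:
  assumes "s < - 1"
  shows "summable (\<lambda>n. (real n + 1) powr s)"
proof -
  have "summable (\<lambda>n. real (Suc n) powr s)"
    using assms by (subst summable_Suc_iff) (simp add: summable_real_powr_iff)
  then show ?thesis by (simp add: add.commute)
qed

section \<open>Gauss's summation theorem\<close>

text \<open>
  The terms of the hypergeometric series \<open>\<^sub>2F\<^sub>1(a, b; c; 1)\<close>. Gauss's theorem evaluates their sum. Its
  proof moves \<open>c\<close> to infinity, where only the term \<open>i = 0\<close> survives, by means of a contiguous relation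
  between the series with lower parameter \<open>c\<close> and \<open>c + 1\<close>.
\<close>

definition gauss_term :: "real \<Rightarrow> real \<Rightarrow> real \<Rightarrow> nat \<Rightarrow> real" where
  "gauss_term a b c i = pochhammer a i * pochhammer b i / (pochhammer c i * fact i)"

lemma gauss_term_le:
  assumes "c > 0"
  obtains K where "K > 0" "\<And>i. \<bar>gauss_term a b c i\<bar> \<le> K * (real i + 1) powr (a + b - c - 1)"
proof -
  have 1: "c \<notin> \<int>\<^sub>\<le>\<^sub>0" "(1::real) \<notin> \<int>\<^sub>\<le>\<^sub>0"
    using assms by (auto dest: nonpos_Ints_nonpos)
  obtain K1 where K1: "K1 > 0"
      "\<And>n. \<bar>pochhammer a n / pochhammer c n\<bar> \<le> K1 * (real n + 1) powr (a - c)"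
    using pochhammer_quotient_le[OF 1(1)] by metis
  obtain K2 where K2: "K2 > 0"
      "\<And>n. \<bar>pochhammer b n / pochhammer 1 n\<bar> \<le> K2 * (real n + 1) powr (b - 1)"
    using pochhammer_quotient_le[OF 1(2)] by metis
  show ?thesis
  proof
    show "K1 * K2 > 0" using K1 K2 by simp
    fix i
    have "\<bar>gauss_term a b c i\<bar> = \<bar>pochhammer a i / pochhammer c i\<bar> * \<bar>pochhammer b i / pochhammer 1 i\<bar>"
      by (simp add: gauss_term_def abs_mult pochhammer_fact[symmetric])
    also have "\<dots> \<le> (K1 * (real i + 1) powr (a - c)) * (K2 * (real i + 1) powr (b - 1))"
      using K1 K2 by (intro mult_mono) auto
    also have "\<dots> = K1 * K2 * (real i + 1) powr (a + b - c - 1)"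
      by (simp add: powr_add[symmetric] algebra_simps)
    finally show "\<bar>gauss_term a b c i\<bar> \<le> K1 * K2 * (real i + 1) powr (a + b - c - 1)" .
  qed
qed

lemma gauss_term_abs_summable:
  assumes "c > 0" "c - a - b > 0"
  shows "summable (\<lambda>i. \<bar>gauss_term a b c i\<bar>)"
proof -
  obtain K where K: "\<And>i. \<bar>gauss_term a b c i\<bar> \<le> K * (real i + 1) powr (a + b - c - 1)"
    using gauss_term_le[OF assms(1)] by metis
  show ?thesis
    by (rule summable_comparison_test'[OF summable_mult[OF summable_Suc_powr], where N = 0])
      (use assms K in auto)
qed

lemma gauss_contiguous:
  assumes "c > 0" "c - a - b > 0"
  shows "c * (c - a - b) * suminf (gauss_term a b c)
       = (c - a) * (c - b) * suminf (gauss_term a b (c + 1))"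
proof -
  let ?t = "gauss_term a b c" and ?s = "gauss_term a b (c + 1)"
  have t: "summable ?t" and s: "summable ?s"
    using gauss_term_abs_summable[of c a b] gauss_term_abs_summable[of "c + 1" a b] assms
    by (auto intro: summable_rabs_cancel)
  \<comment> \<open>The difference of the two sides is, term by term, the difference of consecutive values of \<open>G\<close>;
    \<open>G\<close> vanishes at \<open>0\<close> and at infinity.\<close>
  define G where "G i = - c * real i * ?t i" for i
  have step: "c * (c - a - b) * ?t i - (c - a) * (c - b) * ?s i = G (Suc i) - G i" for i
  proof -
    have ci: "c + real i > 0" using assms by simp
    have pc: "pochhammer c i > 0" using assms by (simp add: pochhammer_pos)
    have pc1: "pochhammer (c + 1) i > 0" using assms by (simp add: pochhammer_pos)
    have "c * pochhammer (c + 1) i = pochhammer c i * (c + real i)"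
      using pochhammer_rec[of c i] by (simp add: pochhammer_Suc)
    then have "pochhammer (c + 1) i = pochhammer c i * (c + real i) / c"
      using assms by (simp add: field_simps)
    then have si: "?s i = ?t i * (c / (c + real i))"
      by (simp add: gauss_term_def)
    have tS: "real (Suc i) * ?t (Suc i) = ?t i * ((a + real i) * (b + real i) / (c + real i))"
    proof -
      have "?t (Suc i) = ?t i * ((a + real i) * (b + real i) / ((c + real i) * real (Suc i)))"
        by (simp add: gauss_term_def pochhammer_Suc mult_ac)
      then show ?thesis by simp
    qed
    have "G (Suc i) = - c * (?t i * ((a + real i) * (b + real i) / (c + real i)))"
      unfolding tS[symmetric] by (simp add: G_def)
    then show ?thesis
      unfolding si using ci by (simp add: G_def field_simps) 
  qed
  have "G \<longlonglongrightarrow> 0"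
  proof -
    obtain K where K: "K > 0" "\<And>i. \<bar>?t i\<bar> \<le> K * (real i + 1) powr (a + b - c - 1)"
      using gauss_term_le[OF assms(1)] by metis
    have "(\<lambda>i. c * real i * (K * (real i + 1) powr (a + b - c - 1))) \<longlonglongrightarrow> 0"
      using assms K(1) by real_asymp
    then show ?thesis
    proof (rule tendsto_0_le[where K = 1], intro always_eventually allI)
      fix i
      have "norm (G i) = c * real i * \<bar>?t i\<bar>"
        using assms by (simp add: G_def abs_mult)
      also have "\<dots> \<le> c * real i * (K * (real i + 1) powr (a + b - c - 1))"
        using K assms by (intro mult_left_mono) auto
      finally show "norm (G i) \<le> norm (c * real i * (K * (real i + 1) powr (a + b - c - 1))) * 1"
        using K(1) assms by (simp add: abs_mult)
    qed
  qed
  from telescope_sums[OF this]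
  have "(\<lambda>i. c * (c - a - b) * ?t i - (c - a) * (c - b) * ?s i) sums 0"
    unfolding step by (simp add: G_def)
  moreover have "(\<lambda>i. c * (c - a - b) * ?t i - (c - a) * (c - b) * ?s i) sums
      (c * (c - a - b) * suminf ?t - (c - a) * (c - b) * suminf ?s)"
    by (intro sums_diff sums_mult summable_sums t s)
  ultimately show ?thesis using sums_unique2 by fastforce
qed

lemma gauss_shift:
  assumes "c > 0" "c - a - b > 0"
  shows "pochhammer c n * pochhammer (c - a - b) n * suminf (gauss_term a b c)
       = pochhammer (c - a) n * pochhammer (c - b) n * suminf (gauss_term a b (c + real n))"
proof (induction n)
  case (Suc n)
  have "pochhammer c (Suc n) * pochhammer (c - a - b) (Suc n) * suminf (gauss_term a b c)
      = (c + real n) * (c - a - b + real n) *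
          (pochhammer c n * pochhammer (c - a - b) n * suminf (gauss_term a b c))"
    by (simp add: pochhammer_Suc)
  also have "\<dots> = pochhammer (c - a) n * pochhammer (c - b) n *
      ((c + real n) * (c + real n - a - b) * suminf (gauss_term a b (c + real n)))"
    unfolding Suc by (simp add: algebra_simps)
  also have "(c + real n) * (c + real n - a - b) * suminf (gauss_term a b (c + real n))
      = (c + real n - a) * (c + real n - b) * suminf (gauss_term a b (c + real n + 1))"
    using assms by (intro gauss_contiguous) auto
  finally show ?case
    by (simp add: pochhammer_Suc algebra_simps)
qed simp

text \<open>
  Raising \<open>c\<close> only enlarges the denominators, so the series for \<open>c\<close> dominates all the later ones, and
  every term but the first tends to zero.
\<close>

lemma gauss_limit:
  assumes "c > 0" "c - a - b > 0"
  shows "(\<lambda>n. suminf (gauss_term a b (c + real n))) \<longlonglongrightarrow> 1"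
proof -
  define w :: "nat \<Rightarrow> real" where "w i = (if i = 0 then 1 else 0)" for i
  have "summable (\<lambda>i. \<bar>gauss_term a b c i\<bar>)"
    by (rule gauss_term_abs_summable[OF assms])
  moreover have "(\<lambda>n. gauss_term a b (c + real n) i) \<longlonglongrightarrow> w i" for i
  proof (cases i)
    case (Suc j)
    have "filterlim (\<lambda>n. pochhammer (c + real n) i) at_top sequentially"
    proof (rule filterlim_at_top_mono[OF filterlim_real_sequentially], intro always_eventually allI)
      fix n
      show "real n \<le> pochhammer (c + real n) i"
      proof -
        have "real n \<le> (c + real n) * 1"
          using assms by simp
        also have "\<dots> \<le> (c + real n) * (\<Prod>l=0..<j. c + real n + 1 + real l)"
          using assms by (intro mult_left_mono prod_ge_1) auto
        also have "\<dots> = pochhammer (c + real n) i"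
          unfolding Suc pochhammer_rec by (simp add: pochhammer_prod)
        finally show ?thesis .
      qed
    qed
    then have "(\<lambda>n. pochhammer a i * pochhammer b i / fact i / pochhammer (c + real n) i) \<longlonglongrightarrow> 0"
      by (intro tendsto_divide_0[OF tendsto_const] filterlim_at_top_imp_at_infinity)
    then show ?thesis using Suc by (simp add: gauss_term_def w_def mult.commute)
  qed (simp add: gauss_term_def w_def)
  moreover have "\<bar>gauss_term a b (c + real n) i\<bar> \<le> \<bar>gauss_term a b c i\<bar>" for n i
  proof -
    have "pochhammer c i \<le> pochhammer (c + real n) i" "pochhammer c i > 0"
      using assms by (auto simp: pochhammer_prod pochhammer_pos intro!: prod_mono prod_pos)
    then show ?thesis
      by (auto simp: gauss_term_def abs_mult intro!: divide_left_mono mult_mono mult_pos_pos)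
  qed
  ultimately have "(\<lambda>n. suminf (gauss_term a b (c + real n))) \<longlonglongrightarrow> suminf w"
    using tannerys_theorem[of "\<lambda>i n. gauss_term a b (c + real n) i" w sequentially
        "\<lambda>i. \<bar>gauss_term a b c i\<bar>"] by (simp add: case_prod_unfold)
  moreover have "w sums 1"
    using sums_If_finite_set[of "{0}" "\<lambda>_. 1::real"] by (simp add: w_def[abs_def])
  ultimately show ?thesis by (simp add: sums_iff)
qed

text \<open>
  The product of the factors collected in \<open>gauss_shift\<close> is a quotient of Pochhammer symbols whose
  powers of \<open>n\<close> cancel; its limit is the quotient of Gamma functions.
\<close>

theorem gauss_summation:
  assumes "c > 0" "c - a - b > 0"
  shows "gauss_term a b c sums (Gamma c * Gamma (c - a - b) * rGamma (c - a) * rGamma (c - b))"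
proof -
  let ?S = "suminf (gauss_term a b c)"
  have npi: "c \<notin> \<int>\<^sub>\<le>\<^sub>0" "c - a - b \<notin> \<int>\<^sub>\<le>\<^sub>0"
    using assms by (auto dest: nonpos_Ints_nonpos)
  have "(\<lambda>n. (pochhammer (c - a) n / pochhammer c n / (real n + 1) powr ((c - a) - c)) *
        (pochhammer (c - b) n / pochhammer (c - a - b) n / (real n + 1) powr ((c - b) - (c - a - b)))
        * suminf (gauss_term a b (c + real n)))
      \<longlonglongrightarrow> (rGamma (c - a) * Gamma c) * (rGamma (c - b) * Gamma (c - a - b)) * 1"
    by (intro tendsto_mult pochhammer_quotient_asymp gauss_limit assms npi)
  moreover have "(pochhammer (c - a) n / pochhammer c n / (real n + 1) powr ((c - a) - c)) *
        (pochhammer (c - b) n / pochhammer (c - a - b) n / (real n + 1) powr ((c - b) - (c - a - b)))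
        * suminf (gauss_term a b (c + real n)) = ?S" for n
  proof -
    have "pochhammer c n > 0" "pochhammer (c - a - b) n > 0"
      using assms by (simp_all only: pochhammer_pos)
    moreover define p q where "p = (real n + 1) powr ((c - a) - c)"
      and "q = (real n + 1) powr ((c - b) - (c - a - b))"
    moreover have "p * q = 1"
      unfolding p_def q_def by (simp flip: powr_add)
    ultimately show ?thesis
      unfolding p_def[symmetric] q_def[symmetric]
      using gauss_shift[OF assms, of n] by (simp add: divide_simps) algebra
  qed
  ultimately have "(\<lambda>n::nat. ?S) \<longlonglongrightarrow> (rGamma (c - a) * Gamma c) * (rGamma (c - b) * Gamma (c - a - b)) * 1"
    by simp
  then have "?S = Gamma c * Gamma (c - a - b) * rGamma (c - a) * rGamma (c - b)"
    using LIMSEQ_unique[OF tendsto_const] by (auto simp: algebra_simps)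
  moreover have "summable (gauss_term a b c)"
    using gauss_term_abs_summable[OF assms] by (rule summable_rabs_cancel)
  ultimately show ?thesis by (simp add: sums_iff)
qed

section \<open>Autocorrelations of the fractional difference weights\<close>

lemma frac_diff_coeff_eq_pochhammer:
  assumes "- d \<notin> \<int>\<^sub>\<le>\<^sub>0"
  shows "frac_diff_coeff d j = pochhammer (- d) j / fact j"
  using pochhammer_Gamma[OF assms, of j] Gamma_fact[of j, where 'a = real]
  by (simp add: frac_diff_coeff_def add.commute)

text \<open>
  The autocovariance at lag \<open>x\<close> of \<open>(1 - L)\<^sup>d\<close> applied to white noise of variance \<open>1\<close>. The lag is a real
  number because the hypergeometric formulas also evaluate the expression at \<open>- k\<close>.
\<close>

definition frac_autocov :: "real \<Rightarrow> real \<Rightarrow> real" where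
  "frac_autocov d x =
     Gamma (1 + 2 * d) / (Gamma (- d) * Gamma (1 + d)) * (Gamma (- d + x) / Gamma (1 + d + x))"

lemma Gamma_nonzero_pos: "x > 0 \<Longrightarrow> Gamma (x::real) \<noteq> 0"
  using Gamma_real_pos[of x] by linarith

lemma frac_diff_coeff_gauss_term:
  assumes "- d \<notin> \<int>\<^sub>\<le>\<^sub>0"
  shows "frac_diff_coeff d i * frac_diff_coeff d (i + h) =
    pochhammer (- d) h / fact h * gauss_term (- d) (real h - d) (real h + 1) i"
proof -
  have "pochhammer (- d) (h + i) = pochhammer (- d) h * pochhammer (real h - d) i"
    by (simp add: pochhammer_product')
  moreover have "fact (h + i) = (fact h * pochhammer (real h + 1) i :: real)"
    by (simp add: pochhammer_fact pochhammer_product' add.commute)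
  ultimately show ?thesis
    using assms by (simp add: frac_diff_coeff_eq_pochhammer gauss_term_def add.commute mult_ac)
qed

lemma frac_diff_coeff_prod_abs_summable:
  assumes "d > - 1 / 2" "- d \<notin> \<int>\<^sub>\<le>\<^sub>0"
  shows "summable (\<lambda>i. \<bar>frac_diff_coeff d i * frac_diff_coeff d (i + h)\<bar>)"
  unfolding frac_diff_coeff_gauss_term[OF assms(2)] abs_mult
  by (intro summable_mult gauss_term_abs_summable) (use assms in simp_all)

text \<open>
  Up to the factor \<open>\<pi>\<^sub>h\<close>, the autocorrelation at lag \<open>h\<close> is the Gauss series with parameters
  \<open>- d\<close>, \<open>h - d\<close> and \<open>h + 1\<close>.
\<close>

lemma frac_diff_coeff_prod_sums:
  assumes "d > - 1 / 2" "- d \<notin> \<int>\<^sub>\<le>\<^sub>0"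
  shows "(\<lambda>i. frac_diff_coeff d i * frac_diff_coeff d (i + h)) sums frac_autocov d (real h)"
proof -
  have "gauss_term (- d) (real h - d) (real h + 1) sums
     (Gamma (real h + 1) * Gamma (real h + 1 - (- d) - (real h - d)) *
      rGamma (real h + 1 - (- d)) * rGamma (real h + 1 - (real h - d)))"
    using assms by (intro gauss_summation) auto
  moreover have "real h + 1 - (- d) - (real h - d) = 1 + 2 * d" "real h + 1 - (- d) = 1 + d + real h"
      "real h + 1 - (real h - d) = 1 + d"
    by simp_all
  ultimately have "gauss_term (- d) (real h - d) (real h + 1) sums
     (Gamma (real h + 1) * Gamma (1 + 2 * d) * rGamma (1 + d + real h) * rGamma (1 + d))"
    by (simp only:)
  then have "(\<lambda>i. frac_diff_coeff d i * frac_diff_coeff d (i + h)) sums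
      (pochhammer (- d) h / fact h *
        (Gamma (real h + 1) * Gamma (1 + 2 * d) * rGamma (1 + d + real h) * rGamma (1 + d)))"
    unfolding frac_diff_coeff_gauss_term[OF assms(2)]
    by (rule sums_mult)
  moreover have "pochhammer (- d) h = Gamma (- d + real h) / Gamma (- d)"
    by (rule pochhammer_Gamma[OF assms(2)])
  moreover have "Gamma (real h + 1) = fact h"
    using Gamma_fact[of h, where 'a = real] by (simp add: add.commute)
  moreover have "Gamma (- d + real h) / Gamma (- d) / fact h *
      (fact h * Gamma (1 + 2 * d) * rGamma (1 + d + real h) * rGamma (1 + d))
      = frac_autocov d (real h)"
    by (simp add: frac_autocov_def rGamma_inverse_Gamma divide_inverse)
  ultimately show ?thesis by simp
qed

lemma frac_diff_coeff_prod_nonneg: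
  assumes "- d \<notin> \<int>\<^sub>\<le>\<^sub>0" "d < 1" "i > 0"
  shows "frac_diff_coeff d i * frac_diff_coeff d (i + h) \<ge> 0"
proof -
  have *: "frac_diff_coeff d (Suc j) = - d * (pochhammer (1 - d) j / fact (Suc j))" for j
    using assms by (simp add: frac_diff_coeff_eq_pochhammer pochhammer_rec)
  obtain j where j: "i = Suc j"
    using assms by (cases i) auto
  define u v where "u = pochhammer (1 - d) j / fact (Suc j)"
    and "v = pochhammer (1 - d) (j + h) / fact (Suc (j + h))"
  have "u \<ge> 0" "v \<ge> 0"
    using assms by (simp_all add: u_def v_def pochhammer_nonneg)
  moreover have "frac_diff_coeff d i * frac_diff_coeff d (i + h) = d\<^sup>2 * (u * v)"
    unfolding j add_Suc * u_def[symmetric] v_def[symmetric] by (simp add: power2_eq_square)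
  ultimately show ?thesis by simp
qed

text \<open>
  Apart from the leading weight, which is \<open>1\<close>, all weights have the same sign.
  Hence taking absolute values changes an autocorrelation only in its first summand.
\<close>
lemma frac_diff_coeff_prod_abs_suminf_le:
  assumes "d > - 1 / 2" "- d \<notin> \<int>\<^sub>\<le>\<^sub>0" "d < 1"
  shows "(\<Sum>i. \<bar>frac_diff_coeff d i * frac_diff_coeff d (i + h)\<bar>)
       \<le> \<bar>frac_autocov d (real h)\<bar> + 2 * \<bar>frac_diff_coeff d h\<bar>"
proof -
  let ?f = "\<lambda>i. frac_diff_coeff d i * frac_diff_coeff d (i + h)"
  have s: "summable (\<lambda>i. \<bar>?f i\<bar>)"
    by (rule frac_diff_coeff_prod_abs_summable[OF assms(1,2)])
  then have s': "summable ?f"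
    by (rule summable_rabs_cancel)
  have f0: "?f 0 = frac_diff_coeff d h"
    using assms by (simp add: frac_diff_coeff_eq_pochhammer[of d 0])
  have "(\<Sum>i. \<bar>?f i\<bar>) = \<bar>?f 0\<bar> + (\<Sum>i. \<bar>?f (Suc i)\<bar>)"
    using suminf_split_head[OF s] by simp
  also have "(\<Sum>i. \<bar>?f (Suc i)\<bar>) = (\<Sum>i. ?f (Suc i))"
    by (intro suminf_cong abs_of_nonneg frac_diff_coeff_prod_nonneg[OF assms(2,3)]) simp
  also have "(\<Sum>i. ?f (Suc i)) = suminf ?f - ?f 0"
    by (rule suminf_split_head[OF s'])
  also have "suminf ?f = frac_autocov d (real h)"
    using frac_diff_coeff_prod_sums[OF assms(1,2)] by (simp add: sums_iff)
  finally show ?thesis unfolding f0 by simp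
qed

lemma frac_diff_coeff_le:
  assumes "- d \<notin> \<int>\<^sub>\<le>\<^sub>0"
  obtains K where "K > 0" "\<And>h. \<bar>frac_diff_coeff d h\<bar> \<le> K * (real h + 1) powr (- d - 1)"
proof -
  obtain K where K: "K > 0" "\<And>n. \<bar>pochhammer (- d) n\<bar> \<le> K * (fact n * (real n + 1) powr (- d - 1))"
    using pochhammer_le[of "- d"] by metis
  show ?thesis
    by (rule that[OF K(1)])
      (use K(2) assms in \<open>simp add: frac_diff_coeff_eq_pochhammer pos_divide_le_eq mult_ac\<close>)
qed

lemma frac_autocov_nat:
  assumes "- d + x \<notin> \<int>\<^sub>\<le>\<^sub>0" "1 + d + x \<notin> \<int>\<^sub>\<le>\<^sub>0"
  shows "frac_autocov d (x + real h) =
    frac_autocov d x * (pochhammer (- d + x) h / pochhammer (1 + d + x) h)"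
proof -
  have "Gamma (- d + x) \<noteq> 0" "Gamma (1 + d + x) \<noteq> 0"
    using assms by (auto simp: Gamma_eq_zero_iff)
  then show ?thesis
    using pochhammer_Gamma[OF assms(1), of h] pochhammer_Gamma[OF assms(2), of h]
    by (simp add: frac_autocov_def algebra_simps)
qed

lemma frac_autocov_le:
  assumes "- d \<notin> \<int>\<^sub>\<le>\<^sub>0" "d > - 1"
  obtains K where "K > 0" "\<And>h. \<bar>frac_autocov d (real h)\<bar> \<le> K * (real h + 1) powr (- 2 * d - 1)"
proof -
  have npi: "1 + d \<notin> \<int>\<^sub>\<le>\<^sub>0"
    using assms by (auto dest: nonpos_Ints_nonpos)
  obtain K where K: "K > 0"
      "\<And>h. \<bar>pochhammer (- d) h / pochhammer (1 + d) h\<bar> \<le> K * (real h + 1) powr (- d - (1 + d))"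
    using pochhammer_quotient_le[OF npi] by metis
  show ?thesis
  proof
    show "(\<bar>frac_autocov d 0\<bar> + 1) * K > 0" using K by simp
    fix h
    have "\<bar>frac_autocov d (real h)\<bar> = \<bar>frac_autocov d 0\<bar> * \<bar>pochhammer (- d) h / pochhammer (1 + d) h\<bar>"
      using frac_autocov_nat[of d 0 h] assms npi by (simp add: abs_mult)
    also have "\<dots> \<le> (\<bar>frac_autocov d 0\<bar> + 1) * (K * (real h + 1) powr (- d - (1 + d)))"
      using K by (intro mult_mono) auto
    also have "- d - (1 + d) = - 2 * d - 1"
      by simp
    finally show "\<bar>frac_autocov d (real h)\<bar> \<le> (\<bar>frac_autocov d 0\<bar> + 1) * K * (real h + 1) powr (- 2 * d - 1)"
      by (simp only: mult.assoc)
  qed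
qed

text \<open>
  The differences of \<open>\<Gamma>(h - d) / \<Gamma>(h + d)\<close> are \<open>- 2 d\<close> times \<open>\<Gamma>(h - d) / \<Gamma>(1 + d + h)\<close>, so the sum
  telescopes. What matters later is that the two-sided partial sums are positive.
\<close>

lemma sum_frac_autocov:
  assumes "d > 0" "d < 1"
  shows "frac_autocov d 0 + 2 * (\<Sum>h=1..n. frac_autocov d (real h)) =
    Gamma (1 + 2 * d) / (Gamma (1 - d) * Gamma (1 + d)) *
      (Gamma (real n + 1 - d) / Gamma (real n + 1 + d))"
proof -
  have np: "- d \<notin> \<int>\<^sub>\<le>\<^sub>0"
  proof
    assume "- d \<in> \<int>\<^sub>\<le>\<^sub>0"
    then obtain k where "- d = real_of_int k" by (auto elim!: nonpos_Ints_cases)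
    then have "real_of_int k < 0" "real_of_int k > - 1" using assms by auto
    then have "k < 0" "- 1 < k" by simp_all
    then show False by linarith
  qed
  define C where "C = Gamma (1 + 2 * d) / (Gamma (1 - d) * Gamma (1 + d))"
  have g: "Gamma (1 - d) = - d * Gamma (- d)"
    using Gamma_plus1[OF np] by simp
  have nz: "Gamma (- d) \<noteq> 0" "Gamma (1 + d) \<noteq> 0"
    using np Gamma_nonzero_pos[of "1 + d"] assms by (simp_all add: Gamma_eq_zero_iff)
  have fr: "frac_autocov d x = - d * C * (Gamma (x - d) / Gamma (1 + d + x))" for x
    unfolding frac_autocov_def C_def g using assms nz by (simp add: add.commute)
  have "frac_autocov d 0 + 2 * (\<Sum>h=1..n. frac_autocov d (real h))
      = C * (Gamma (real n + 1 - d) / Gamma (real n + 1 + d))"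
  proof (induction n)
    case 0
    show ?case using g by (simp add: fr)
  next
    case (Suc n)
    define u where "u = real n + 1"
    have "u - d > 0" "u + d > 0"
      using assms by (auto simp: u_def)
    then have npu: "u - d \<notin> \<int>\<^sub>\<le>\<^sub>0" "u + d \<notin> \<int>\<^sub>\<le>\<^sub>0"
      by (auto dest: nonpos_Ints_nonpos)
    have 1: "Gamma (u + 1 - d) = (u - d) * Gamma (u - d)"
      using Gamma_plus1[OF npu(1)] by (simp add: add_diff_eq diff_add_eq)
    have 2: "Gamma (u + 1 + d) = (u + d) * Gamma (u + d)"
      using Gamma_plus1[OF npu(2)] by (simp add: ac_simps)
    have 3: "Gamma (u + d) > 0"
      using \<open>u + d > 0\<close> by simp
    have "frac_autocov d 0 + 2 * (\<Sum>h=1..Suc n. frac_autocov d (real h))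
       = C * (Gamma (u - d) / Gamma (u + d)) + 2 * frac_autocov d u"
      using Suc by (simp add: u_def add_ac)
    also have "frac_autocov d u = - d * C * (Gamma (u - d) / Gamma (u + 1 + d))"
      by (simp add: fr ac_simps)
    also have "C * (Gamma (u - d) / Gamma (u + d)) + 2 * (- d * C * (Gamma (u - d) / Gamma (u + 1 + d)))
       = C * (Gamma (u + 1 - d) / Gamma (u + 1 + d))"
      unfolding 1 2 using 3 \<open>u + d > 0\<close> by (simp add: divide_simps) (simp add: algebra_simps)
    finally show ?case by (simp add: u_def add.commute)
  qed
  then show ?thesis by (simp add: C_def)
qed

section \<open>Toeplitz double series\<close>

lemma has_sum_int_halves:
  fixes f :: "int \<Rightarrow> real"
  assumes "summable (\<lambda>n. \<bar>f (int n)\<bar>)" "summable (\<lambda>n. \<bar>f (- int n - 1)\<bar>)"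
  shows "(f has_sum ((\<Sum>n. f (int n)) + (\<Sum>n. f (- int n - 1)))) UNIV"
proof -
  have nonneg: "(f has_sum (\<Sum>n. f (int n))) {0..}"
  proof -
    have "((\<lambda>n. f (int n)) has_sum (\<Sum>n. f (int n))) UNIV"
      by (rule norm_summable_imp_has_sum) (use assms summable_rabs_cancel in auto)
    then show ?thesis
      by (subst has_sum_reindex_bij_witness[of _ int nat]) auto
  qed
  have neg: "(f has_sum (\<Sum>n. f (- int n - 1))) {..<0}"
  proof -
    have "((\<lambda>n. f (- int n - 1)) has_sum (\<Sum>n. f (- int n - 1))) UNIV"
      by (rule norm_summable_imp_has_sum) (use assms summable_rabs_cancel in auto)
    then show ?thesis
      by (subst has_sum_reindex_bij_witness[of _ "\<lambda>n. - int n - 1" "\<lambda>m. nat (- m - 1)"]) auto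
  qed
  have "(f has_sum ((\<Sum>n. f (int n)) + (\<Sum>n. f (- int n - 1)))) ({0..} \<union> {..<0})"
    by (rule has_sum_Un_disjoint[OF nonneg neg]) auto
  moreover have "{0..} \<union> {..<0} = (UNIV :: int set)" by auto
  ultimately show ?thesis by simp
qed

text \<open>
  The summand of the quadratic form depends on \<open>j - i\<close> apart from the weights, so summing along the
  diagonals first produces the autocorrelations \<open>r\<close> of the weights. The hypothesis on absolute values
  makes the family over all pairs summable; then the squares \<open>{..<n} \<times> {..<n}\<close> may be used as well.
\<close>

lemma toeplitz_double_series:
  fixes p :: "nat \<Rightarrow> real" and g :: "int \<Rightarrow> real"
  assumes p: "\<And>h. summable (\<lambda>i. \<bar>p i * p (i + h)\<bar>)"
    and r: "\<And>h. (\<lambda>i. p i * p (i + h)) sums r h"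
    and g: "(\<lambda>m. \<bar>g m\<bar> * (\<Sum>i. \<bar>p i * p (i + nat \<bar>m\<bar>)\<bar>)) summable_on UNIV"
    and S: "((\<lambda>m. g m * r (nat \<bar>m\<bar>)) has_sum S) UNIV"
  shows "(\<lambda>n. \<Sum>i<n. \<Sum>j<n. p i * p j * g (int j - int i)) \<longlonglongrightarrow> S"
proof -
  define f where "f = (\<lambda>(m, l). g m * (p l * p (l + nat \<bar>m\<bar>)))"
  have sumf: "f summable_on UNIV \<times> UNIV"
  proof (rule Infinite_Sum.abs_summable_summable, subst Infinite_Sum.abs_summable_on_Sigma_iff, intro conjI ballI)
    fix m :: int
    have "summable (\<lambda>l. \<bar>g m\<bar> * \<bar>p l * p (l + nat \<bar>m\<bar>)\<bar>)"
      by (intro summable_mult p)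
    moreover have "norm (f (m, l)) = \<bar>g m\<bar> * \<bar>p l * p (l + nat \<bar>m\<bar>)\<bar>" for l
      by (simp add: f_def abs_mult)
    ultimately show "(\<lambda>l. norm (f (m, l))) summable_on UNIV"
      by (subst summable_on_UNIV_nonneg_real_iff) simp_all
  next
    have "(\<Sum>\<^sub>\<infinity>l. norm (f (m, l))) = \<bar>g m\<bar> * (\<Sum>i. \<bar>p i * p (i + nat \<bar>m\<bar>)\<bar>)" for m
    proof -
      have "((\<lambda>l. \<bar>p l * p (l + nat \<bar>m\<bar>)\<bar>) has_sum (\<Sum>i. \<bar>p i * p (i + nat \<bar>m\<bar>)\<bar>)) UNIV"
        by (rule norm_summable_imp_has_sum) (use p in \<open>auto intro: summable_sums\<close>)
      from has_sum_cmult_right[OF this, of "\<bar>g m\<bar>"] show ?thesis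
        by (intro infsumI) (simp add: f_def abs_mult)
    qed
    moreover have "norm (\<Sum>\<^sub>\<infinity>l. norm (f (m, l))) = (\<Sum>\<^sub>\<infinity>l. norm (f (m, l)))" for m
      by (simp add: infsum_nonneg)
    ultimately show "(\<lambda>m. norm (\<Sum>\<^sub>\<infinity>l. norm (f (m, l)))) summable_on UNIV"
      using g by (simp only:)
  qed
  have "(f has_sum S) (UNIV \<times> UNIV)"
  proof (rule has_sum_SigmaI[OF _ S sumf])
    fix m :: int
    have "((\<lambda>l. p l * p (l + nat \<bar>m\<bar>)) has_sum r (nat \<bar>m\<bar>)) UNIV"
      by (rule norm_summable_imp_has_sum) (use p r in auto)
    then show "((\<lambda>y. f (m, y)) has_sum g m * r (nat \<bar>m\<bar>)) UNIV"
      unfolding f_def case_prod_conv by (rule has_sum_cmult_right)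
  qed
  \<comment> \<open>A pair is determined by its difference \<open>m = j - i\<close> and its minimum \<open>l\<close>.\<close>
  moreover have "f (int j - int i, min i j) = p i * p j * g (int j - int i)" for i j
  proof (cases "i \<le> j")
    case True
    then have "nat \<bar>int j - int i\<bar> = j - i" "min i j = i" "i + (j - i) = j" by auto
    then show ?thesis by (simp add: f_def)
  next
    case False
    then have "nat \<bar>int j - int i\<bar> = i - j" "min i j = j" "j + (i - j) = i" by auto
    then show ?thesis by (simp add: f_def)
  qed
  ultimately have "((\<lambda>(i, j). p i * p j * g (int j - int i)) has_sum S) (UNIV \<times> UNIV)"
    by (subst has_sum_reindex_bij_witness[of _
          "\<lambda>(m, l). if m \<ge> 0 then (l, l + nat m) else (l + nat (- m), l)"
          "\<lambda>(i, j). (int j - int i, min i j)" _ f]) (auto split: if_splits)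
  then have "filterlim (sum (\<lambda>(i, j). p i * p j * g (int j - int i))) (nhds S)
      (finite_subsets_at_top (UNIV \<times> UNIV))"
    by (simp add: has_sum_def)
  moreover have "filterlim (\<lambda>n. {..<n} \<times> {..<n} :: (nat \<times> nat) set) (finite_subsets_at_top (UNIV \<times> UNIV)) sequentially"
    unfolding filterlim_finite_subsets_at_top
  proof (intro allI impI)
    fix X :: "(nat \<times> nat) set"
    assume "finite X \<and> X \<subseteq> UNIV \<times> UNIV"
    then have "finite (fst ` X \<union> snd ` X)" by simp
    then obtain N where N: "fst ` X \<union> snd ` X \<subseteq> {..<N}"
      using finite_nat_iff_bounded by blast
    show "\<forall>\<^sub>F n in sequentially. finite ({..<n} \<times> {..<n}) \<and> X \<subseteq> {..<n} \<times> {..<n} \<and> {..<n} \<times> {..<n} \<subseteq> UNIV \<times> UNIV"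
      using eventually_ge_at_top[of N]
    proof eventually_elim
      case (elim n)
      have "X \<subseteq> {..<n} \<times> {..<n}"
      proof
        fix x assume "x \<in> X"
        then have "fst x \<in> fst ` X \<union> snd ` X" "snd x \<in> fst ` X \<union> snd ` X"
          by auto
        then have "fst x \<in> {..<N}" "snd x \<in> {..<N}"
          using N by (auto simp only: subset_iff)
        then show "x \<in> {..<n} \<times> {..<n}" using elim by (cases x) auto
      qed
      then show ?case by simp
    qed
  qed
  ultimately have "((\<lambda>n. sum (\<lambda>(i, j). p i * p j * g (int j - int i)) ({..<n} \<times> {..<n})) \<longlongrightarrow> S) sequentially"
    by (rule filterlim_compose)
  then show ?thesis by (simp add: sum.cartesian_product)
qed

section \<open>The autocovariances of the aggregate\<close>

definition csa_autocov :: "real \<Rightarrow> real \<Rightarrow> real \<Rightarrow> int \<Rightarrow> real" where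
  "csa_autocov a b \<sigma> h = \<sigma>\<^sup>2 * Beta (a + \<bar>real_of_int h\<bar> / 2) (b - 1) / Beta a b"

lemma Beta_real_pos: "x > 0 \<Longrightarrow> y > 0 \<Longrightarrow> Beta x (y :: real) > 0"
  by (simp add: Beta_def)

lemma Beta_add_nat:
  fixes x w :: real
  assumes "x > 0" "w > 0"
  shows "Beta (x + real m) w = Beta x w * (pochhammer x m / pochhammer (x + w) m)"
proof -
  have "x \<notin> \<int>\<^sub>\<le>\<^sub>0" "x + w \<notin> \<int>\<^sub>\<le>\<^sub>0"
    using assms by (auto dest: nonpos_Ints_nonpos)
  then have "Gamma (x + real m) = Gamma x * pochhammer x m"
    "Gamma (x + w + real m) = Gamma (x + w) * pochhammer (x + w) m"
    by (auto simp: pochhammer_Gamma Gamma_eq_zero_iff)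
  then show ?thesis
    by (simp add: Beta_def add_ac)
qed

lemma csa_autocov_even:
  assumes "a > 0" "b > 1"
  shows "csa_autocov a b \<sigma> (int (2 * m)) =
    \<sigma>\<^sup>2 / Beta a b * Beta a (b - 1) * (pochhammer a m / pochhammer (a + b - 1) m)"
  using Beta_add_nat[of a "b - 1" m] assms by (simp add: csa_autocov_def add_diff_eq mult_ac)

lemma csa_autocov_odd:
  assumes "a > 0" "b > 1"
  shows "csa_autocov a b \<sigma> (int (2 * m + 1)) =
    \<sigma>\<^sup>2 / Beta a b * Beta (a + 1/2) (b - 1) * (pochhammer (a + 1/2) m / pochhammer (a + b - 1/2) m)"
proof -
  have "a + \<bar>real_of_int (int (2 * m + 1))\<bar> / 2 = a + 1/2 + real m" "a + 1/2 + (b - 1) = a + b - 1/2"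
    by (simp_all add: field_simps)
  then have "csa_autocov a b \<sigma> (int (2 * m + 1)) = \<sigma>\<^sup>2 * Beta (a + 1/2 + real m) (b - 1) / Beta a b"
    unfolding csa_autocov_def by (simp only:)
  then show ?thesis
    using Beta_add_nat[of "a + 1/2" "b - 1" m] assms by (simp add: mult_ac)
qed

lemma csa_autocov_pos:
  assumes "a > 0" "b > 1" "\<sigma> > 0"
  shows "csa_autocov a b \<sigma> h > 0"
  using assms by (simp add: csa_autocov_def Beta_real_pos add_pos_nonneg)

lemma csa_autocov_antimono:
  assumes "a > 0" "b > 1" "\<bar>h\<bar> \<le> \<bar>k\<bar>"
  shows "csa_autocov a b \<sigma> k \<le> csa_autocov a b \<sigma> h"
proof -
  have "\<bar>real_of_int h\<bar> \<le> \<bar>real_of_int k\<bar>"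
    using assms(3) by linarith
  then have "Beta (a + \<bar>real_of_int k\<bar> / 2) (b - 1) \<le> Beta (a + \<bar>real_of_int h\<bar> / 2) (b - 1)"
    using assms by (intro Beta_real_mono) auto
  moreover have "Beta a b > 0"
    using assms by (simp add: Beta_real_pos)
  ultimately show ?thesis
    by (simp add: csa_autocov_def divide_right_mono mult_left_mono)
qed

lemma csa_autocov_minus: "csa_autocov a b \<sigma> (- h) = csa_autocov a b \<sigma> h"
  by (simp add: csa_autocov_def)

text \<open>
  An odd lag is bounded by the even lag before it, where the autocovariance is a quotient of
  Pochhammer symbols.
\<close>

lemma csa_autocov_le:
  assumes "a > 0" "b > 1"
  obtains K where "K > 0" "\<And>h. csa_autocov a b \<sigma> (int h) \<le> K * (real h + 1) powr (1 - b)"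
proof -
  define c where "c = \<sigma>\<^sup>2 / Beta a b * Beta a (b - 1)"
  have c: "c \<ge> 0"
    using assms Beta_real_pos[of a b] Beta_real_pos[of a "b - 1"] by (simp add: c_def)
  have "a + b - 1 \<notin> \<int>\<^sub>\<le>\<^sub>0"
    using assms by (auto dest: nonpos_Ints_nonpos)
  from pochhammer_quotient_le[OF this, of a]
  obtain K where K: "K > 0"
      "\<And>n. \<bar>pochhammer a n / pochhammer (a + b - 1) n\<bar> \<le> K * (real n + 1) powr (a - (a + b - 1))"
    by metis
  show ?thesis
  proof
    show "(c + 1) * (K * (1 / 2) powr (1 - b)) > 0"
      using K c by simp
    fix h :: nat
    define m where "m = h div 2"
    have m: "2 * m \<le> h" "(1 / 2) * (real h + 1) \<le> real m + 1"
      by (auto simp: m_def)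
    have "csa_autocov a b \<sigma> (int h) \<le> csa_autocov a b \<sigma> (int (2 * m))"
      using m assms by (intro csa_autocov_antimono) auto
    also have "\<dots> = c * (pochhammer a m / pochhammer (a + b - 1) m)"
      using csa_autocov_even[OF assms] by (simp add: c_def)
    also have "\<dots> \<le> (c + 1) * (K * (real m + 1) powr (1 - b))"
    proof (rule mult_mono)
      show "pochhammer a m / pochhammer (a + b - 1) m \<le> K * (real m + 1) powr (1 - b)"
        using K(2)[of m] by (simp only: abs_le_iff) simp
      show "0 \<le> pochhammer a m / pochhammer (a + b - 1) m"
        using assms by (intro divide_nonneg_nonneg pochhammer_nonneg) auto
    qed (use c in auto)
    also have "\<dots> \<le> (c + 1) * (K * ((1 / 2) * (real h + 1)) powr (1 - b))"
      using K c m assms by (intro mult_left_mono powr_mono2') auto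
    also have "((1 / 2) * (real h + 1)) powr (1 - b) = (1 / 2) powr (1 - b) * (real h + 1) powr (1 - b)"
      by (rule powr_mult)
    finally show "csa_autocov a b \<sigma> (int h) \<le> (c + 1) * (K * (1 / 2) powr (1 - b)) * (real h + 1) powr (1 - b)"
      by (simp only: mult.assoc)
  qed
qed

section \<open>Splitting into hypergeometric series\<close>

lemma suminf_even_odd:
  fixes f :: "nat \<Rightarrow> real"
  assumes "summable (\<lambda>n. \<bar>f n\<bar>)"
  shows "summable (\<lambda>m. f (2 * m))" "summable (\<lambda>m. f (2 * m + 1))"
    "suminf f = (\<Sum>m. f (2 * m)) + (\<Sum>m. f (2 * m + 1))"
proof -
  have *: "summable (\<lambda>m. f (g m))" if "inj g" for g :: "nat \<Rightarrow> nat"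
    using summable_reindex[OF assms that] by (intro summable_rabs_cancel[of "\<lambda>m. f (g m)"]) (simp add: o_def)
  show e: "summable (\<lambda>m. f (2 * m))" and o: "summable (\<lambda>m. f (2 * m + 1))"
    by (rule *, simp add: inj_def)+
  have "(\<lambda>n. if even n then f (2 * (n div 2)) else f (2 * ((n - 1) div 2) + 1))
      sums ((\<Sum>m. f (2 * m)) + (\<Sum>m. f (2 * m + 1)))"
    using sums_if[OF summable_sums[OF o] summable_sums[OF e]] by (simp add: add.commute)
  moreover have "(\<lambda>n. if even n then f (2 * (n div 2)) else f (2 * ((n - 1) div 2) + 1)) = f"
    by (auto simp: fun_eq_iff elim!: oddE)
  ultimately show "suminf f = (\<Sum>m. f (2 * m)) + (\<Sum>m. f (2 * m + 1))"
    by (simp add: sums_iff)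
qed

lemma suminf_cmult_nonzero:
  fixes f :: "nat \<Rightarrow> real"
  assumes "c \<noteq> 0" "summable (\<lambda>n. c * f n)"
  shows "(\<Sum>n. c * f n) = c * suminf f"
  using assms by (simp add: summable_cmult_iff suminf_mult)

lemma pochhammer_double_half:
  "pochhammer (z::real) (2 * m) = 2 ^ (2 * m) * pochhammer (z / 2) m * pochhammer ((1 + z) / 2) m"
  using pochhammer_double[of "z / 2" m] by (simp add: add_divide_distrib add.commute)

text \<open>
  The autocovariance advances by a full unit of its Beta argument in two lags, while \<open>frac_autocov\<close>
  advances by one unit in one lag. The duplication formula for Pochhammer symbols of even length
  brings the two to the same step within each parity class; at the odd lags one factor
  \<open>(- d + x) / (1 + d + x)\<close> is left over.
\<close>

lemma csa_frac_autocov_suminf: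
  assumes "a > 0" "b > 1" "\<sigma> > 0"
    and npi: "- d + x \<notin> \<int>\<^sub>\<le>\<^sub>0" "1 + d + x \<notin> \<int>\<^sub>\<le>\<^sub>0"
    and nz: "frac_autocov d x \<noteq> 0"
    and s: "summable (\<lambda>h. \<bar>csa_autocov a b \<sigma> (int h) * frac_autocov d (x + real h)\<bar>)"
  shows "(\<Sum>h. csa_autocov a b \<sigma> (int h) * frac_autocov d (x + real h)) =
    \<sigma>\<^sup>2 * frac_autocov d x / Beta a b *
    (Beta a (b - 1) * hypergeom_F [1, a, (1 - d + x) / 2, (- d + x) / 2]
                 [a + b - 1, (2 + d + x) / 2, (1 + d + x) / 2] 1 +
     Beta (a + 1/2) (b - 1) * ((- d + x) / (1 + d + x) *
       hypergeom_F [1, a + 1/2, (1 - d + x) / 2, (2 - d + x) / 2]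
                   [a + b - 1/2, (2 + d + x) / 2, (3 + d + x) / 2] 1))"
proof -
  let ?f = "\<lambda>h. csa_autocov a b \<sigma> (int h) * frac_autocov d (x + real h)"
  note fa = frac_autocov_nat[OF npi]
  have B: "Beta a b > 0" "Beta a (b - 1) > 0" "Beta (a + 1/2) (b - 1) > 0"
    using assms by (auto intro!: Beta_real_pos)
  have dx: "- d + x \<noteq> 0" "1 + d + x \<noteq> 0"
    using npi by (metis zero_in_nonpos_Ints)+
  define c1 where "c1 = \<sigma>\<^sup>2 * frac_autocov d x / Beta a b * Beta a (b - 1)"
  define c2 where "c2 = \<sigma>\<^sup>2 * frac_autocov d x / Beta a b * (Beta (a + 1/2) (b - 1) * ((- d + x) / (1 + d + x)))"
  define f1 where "f1 m = (\<Prod>c\<leftarrow>[1, a, (1 - d + x) / 2, (- d + x) / 2]. pochhammer c m) /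
      (\<Prod>c\<leftarrow>[a + b - 1, (2 + d + x) / 2, (1 + d + x) / 2]. pochhammer c m) * (1 ^ m / fact m)" for m
  define f2 where "f2 m = (\<Prod>c\<leftarrow>[1, a + 1/2, (1 - d + x) / 2, (2 - d + x) / 2]. pochhammer c m) /
      (\<Prod>c\<leftarrow>[a + b - 1/2, (2 + d + x) / 2, (3 + d + x) / 2]. pochhammer c m) * (1 ^ m / fact m)" for m
  have e: "?f (2 * m) = c1 * f1 m" for m
  proof -
    have "pochhammer (- d + x) (2 * m) / pochhammer (1 + d + x) (2 * m) =
      (pochhammer ((- d + x) / 2) m * pochhammer ((1 - d + x) / 2) m) /
      (pochhammer ((1 + d + x) / 2) m * pochhammer ((2 + d + x) / 2) m)"
      unfolding pochhammer_double_half by (simp add: algebra_simps)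
    then have "frac_autocov d (x + real (2 * m)) = frac_autocov d x *
      ((pochhammer ((- d + x) / 2) m * pochhammer ((1 - d + x) / 2) m) /
      (pochhammer ((1 + d + x) / 2) m * pochhammer ((2 + d + x) / 2) m))"
      by (simp only: fa)
    then show ?thesis
      using csa_autocov_even[OF assms(1,2), of \<sigma> m]
      by (simp add: c1_def f1_def pochhammer_fact[symmetric] mult_ac)
  qed
  have o: "?f (2 * m + 1) = c2 * f2 m" for m
  proof -
    have "pochhammer (- d + x) (2 * m + 1) / pochhammer (1 + d + x) (2 * m + 1) =
      (- d + x) / (1 + d + x) * (pochhammer (1 - d + x) (2 * m) / pochhammer (2 + d + x) (2 * m))"
    proof -
      have "- d + x + 1 = 1 - d + x" "1 + d + x + 1 = 2 + d + x" by simp_all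
      then show ?thesis
        using pochhammer_rec[of "- d + x" "2 * m"] pochhammer_rec[of "1 + d + x" "2 * m"]
        by (simp only: Suc_eq_plus1[symmetric] times_divide_times_eq)
    qed
    also have "pochhammer (1 - d + x) (2 * m) / pochhammer (2 + d + x) (2 * m) =
      (pochhammer ((1 - d + x) / 2) m * pochhammer ((2 - d + x) / 2) m) /
      (pochhammer ((2 + d + x) / 2) m * pochhammer ((3 + d + x) / 2) m)"
      unfolding pochhammer_double_half by (simp add: algebra_simps)
    finally have "frac_autocov d (x + real (2 * m + 1)) = frac_autocov d x *
      ((- d + x) / (1 + d + x) * ((pochhammer ((1 - d + x) / 2) m * pochhammer ((2 - d + x) / 2) m) /
      (pochhammer ((2 + d + x) / 2) m * pochhammer ((3 + d + x) / 2) m)))"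
      by (simp only: fa)
    then show ?thesis
      using csa_autocov_odd[OF assms(1,2), of \<sigma> m]
      by (simp add: c2_def f2_def pochhammer_fact[symmetric] mult_ac)
  qed
  have "c1 \<noteq> 0" "c2 \<noteq> 0"
    using B nz dx assms by (simp_all add: c1_def c2_def)
  have "suminf ?f = (\<Sum>m. ?f (2 * m)) + (\<Sum>m. ?f (2 * m + 1))"
    by (rule suminf_even_odd(3)[OF s])
  also have "(\<Sum>m. ?f (2 * m)) = c1 * suminf f1"
    using suminf_even_odd(1)[OF s] \<open>c1 \<noteq> 0\<close> unfolding e by (rule suminf_cmult_nonzero[rotated])
  also have "(\<Sum>m. ?f (2 * m + 1)) = c2 * suminf f2"
    using suminf_even_odd(2)[OF s] \<open>c2 \<noteq> 0\<close> unfolding o by (rule suminf_cmult_nonzero[rotated])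
  finally show ?thesis
    unfolding hypergeom_F_def f1_def[symmetric] f2_def[symmetric] c1_def c2_def
    by (simp add: algebra_simps)
qed

section \<open>The filtered autocovariances\<close>

lemma not_nonpos_Ints:
  fixes x :: real
  assumes "- 1 < x" "x \<noteq> 0"
  shows "x \<notin> \<int>\<^sub>\<le>\<^sub>0"
proof
  assume "x \<in> \<int>\<^sub>\<le>\<^sub>0"
  then obtain n where "x = of_int n" "n \<le> 0" by (auto elim: nonpos_Ints_cases)
  with assms have "n > - 1" "n \<noteq> 0" by auto
  with \<open>n \<le> 0\<close> show False by simp
qed

locale csa_params =
  fixes a b d \<sigma> :: real
  assumes a_pos: "a > 0" and b_gt_1: "b > 1" and b_less_3: "b < 3" and b_not_2: "b \<noteq> 2"
    and d_eq: "d = 1 - b / 2" and sigma_pos: "\<sigma> > 0"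
begin

abbreviation "\<pi> \<equiv> frac_diff_coeff d"
abbreviation "r \<equiv> frac_autocov d"
abbreviation "\<gamma> \<equiv> csa_autocov a b \<sigma>"

lemma d_bounds: "- 1 / 2 < d" "d < 1 / 2" "d \<noteq> 0"
  using b_gt_1 b_less_3 b_not_2 by (auto simp: d_eq)

lemma d_notin_Ints: "d \<notin> \<int>"
proof
  assume "d \<in> \<int>"
  then obtain n where "d = real_of_int n" by (auto elim: Ints_cases)
  with d_bounds have "2 * n < 1" "- 1 < 2 * n" "n \<noteq> 0" by auto
  then show False by presburger
qed

lemma shifted_d_npi: "n \<in> \<int> \<Longrightarrow> d + n \<notin> \<int>\<^sub>\<le>\<^sub>0" "n \<in> \<int> \<Longrightarrow> - d + n \<notin> \<int>\<^sub>\<le>\<^sub>0"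
proof -
  assume n: "n \<in> \<int>"
  show "d + n \<notin> \<int>\<^sub>\<le>\<^sub>0"
    using d_notin_Ints Ints_diff[of "d + n" n] n by (auto dest: nonpos_Ints_Int)
  show "- d + n \<notin> \<int>\<^sub>\<le>\<^sub>0"
    using d_notin_Ints Ints_diff[of n "- d + n"] n by (auto dest: nonpos_Ints_Int)
qed

lemma minus_d_npi: "- d \<notin> \<int>\<^sub>\<le>\<^sub>0"
  using shifted_d_npi(2)[of 0] by simp

text \<open>
  By the reflection formula \<open>r\<close> is an even function on the integers. Only the lags \<open>0\<close> and \<open>1\<close> occur, and
  there the functional equation of \<open>\<Gamma>\<close> suffices.
\<close>

lemma r_minus_1: "r (- 1) = r 1"
proof -
  have 1: "Gamma (- d) = (- d - 1) * Gamma (- d - 1)"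
    using Gamma_plus1[of "- d - 1"] shifted_d_npi(2)[of "- 1"] by simp
  have 2: "Gamma (1 + d) = d * Gamma d"
    using Gamma_plus1[of d] shifted_d_npi(1)[of 0] by (simp add: add.commute)
  have 3: "Gamma (1 - d) = - d * Gamma (- d)"
    using Gamma_plus1[OF minus_d_npi] by simp
  have 4: "Gamma (2 + d) = (1 + d) * Gamma (1 + d)"
    using Gamma_plus1[of "1 + d"] not_nonpos_Ints[of "1 + d"] d_bounds by (simp add: add_ac)
  have nz: "Gamma (- d) \<noteq> 0" "Gamma (1 + d) \<noteq> 0"
    using minus_d_npi Gamma_nonzero_pos[of "1 + d"] d_bounds by (simp_all add: Gamma_eq_zero_iff)
  have eq: "Gamma (- d - 1) = Gamma (- d) / (- d - 1)" "Gamma d = Gamma (1 + d) / d"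
    using 1 2 d_bounds by (simp_all add: nonzero_eq_divide_eq mult.commute)
  have arg: "- d + - 1 = - d - 1" "1 + d + - 1 = d" "- d + 1 = 1 - d" "1 + d + 1 = 2 + d"
    by simp_all
  have "Gamma (- d + - 1) / Gamma (1 + d + - 1) = Gamma (- d + 1) / Gamma (1 + d + 1)"
    unfolding arg eq 3 4 using nz d_bounds by (simp add: divide_simps) (simp add: algebra_simps)
  then show ?thesis by (simp add: frac_autocov_def)
qed

lemma gamma_star_eq: "gamma_star \<sigma> d k = \<sigma>\<^sup>2 * r (- k)"
  by (simp add: gamma_star_def frac_autocov_def)

text \<open>
  One decreasing sequence \<open>Q\<close> controls both the autocorrelations of the weights and those of their
  absolute values. Against the autocovariances, which are of order \<open>h powr (2 * d - 1)\<close>, its two parts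
  leave \<open>h powr (- 2)\<close> and \<open>h powr (d - 2)\<close>, both summable for \<open>d < 1\<close>.
\<close>

lemma domination:
  obtains Q where "\<And>h. (\<Sum>i. \<bar>\<pi> i * \<pi> (i + h)\<bar>) \<le> Q h" "\<And>h. \<bar>r (real h)\<bar> \<le> Q h"
    "\<And>h. Q h \<ge> 0" "\<And>h. Q (Suc h) \<le> Q h" "summable (\<lambda>h. \<gamma> (int h) * Q h)"
proof -
  obtain K1 where K1: "K1 > 0" "\<And>h. \<bar>r (real h)\<bar> \<le> K1 * (real h + 1) powr (- 2 * d - 1)"
  proof -
    have "d > - 1" using d_bounds by simp
    from frac_autocov_le[OF minus_d_npi this] that show ?thesis by metis
  qed
  obtain K2 where K2: "K2 > 0" "\<And>h. \<bar>\<pi> h\<bar> \<le> K2 * (real h + 1) powr (- d - 1)"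
    using frac_diff_coeff_le[OF minus_d_npi] by metis
  obtain K where K: "K > 0" "\<And>h. \<gamma> (int h) \<le> K * (real h + 1) powr (1 - b)"
    using csa_autocov_le[OF a_pos b_gt_1] by metis
  define Q where "Q h = K1 * (real h + 1) powr (- 2 * d - 1) + 2 * (K2 * (real h + 1) powr (- d - 1))" for h :: nat
  show ?thesis
  proof
    fix h
    have "(\<Sum>i. \<bar>\<pi> i * \<pi> (i + h)\<bar>) \<le> \<bar>r (real h)\<bar> + 2 * \<bar>\<pi> h\<bar>"
      using d_bounds minus_d_npi by (intro frac_diff_coeff_prod_abs_suminf_le) auto
    then show "(\<Sum>i. \<bar>\<pi> i * \<pi> (i + h)\<bar>) \<le> Q h"
      unfolding Q_def using K1(2)[of h] K2(2)[of h] by linarith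
    have "0 \<le> 2 * (K2 * (real h + 1) powr (- d - 1))"
      using K2 by simp
    then show "\<bar>r (real h)\<bar> \<le> Q h"
      unfolding Q_def using K1(2)[of h] by linarith
    show "Q h \<ge> 0"
      using K1 K2 by (simp add: Q_def)
    show "Q (Suc h) \<le> Q h"
      unfolding Q_def using K1 K2 d_bounds
      by (intro add_mono mult_left_mono powr_mono2') auto
  next
    have "summable (\<lambda>h. K * K1 * (real h + 1) powr (- 2) + 2 * K * K2 * (real h + 1) powr (d - 2))"
      using d_bounds by (intro summable_add summable_mult summable_Suc_powr) auto
    then show "summable (\<lambda>h. \<gamma> (int h) * Q h)"
    proof (rule summable_comparison_test'[where N = 0])
      fix h :: nat
      have Q: "Q h \<ge> 0"
        using K1 K2 by (simp add: Q_def)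
      have "norm (\<gamma> (int h) * Q h) = \<gamma> (int h) * Q h"
        using Q csa_autocov_pos[OF a_pos b_gt_1 sigma_pos, of "int h"] by (simp add: abs_mult)
      also have "\<dots> \<le> (K * (real h + 1) powr (2 * d - 1)) * Q h"
        using K(2)[of h] Q by (intro mult_right_mono) (auto simp: d_eq)
      also have "\<dots> = K * K1 * ((real h + 1) powr (2 * d - 1) * (real h + 1) powr (- 2 * d - 1))
          + 2 * K * K2 * ((real h + 1) powr (2 * d - 1) * (real h + 1) powr (- d - 1))"
        unfolding Q_def by (simp add: algebra_simps)
      also have "\<dots> = K * K1 * (real h + 1) powr (- 2) + 2 * K * K2 * (real h + 1) powr (d - 2)"
        by (simp add: powr_add[symmetric])
      finally show "norm (\<gamma> (int h) * Q h) \<le> \<dots>" .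
    qed
  qed
qed

text \<open>
  The two series run over the nonnegative lags once with \<open>r(h + k)\<close> and once with \<open>r(h - k)\<close>. Lag
  \<open>0\<close> is counted twice, which is the \<open>- 1\<close> beside \<open>F1\<close> in the definition of \<open>gamma_z\<close>.
\<close>

lemma gamma_z_eq:
  assumes "k = 0 \<or> k = 1"
    and s1: "summable (\<lambda>h. \<bar>\<gamma> (int h) * r (k + real h)\<bar>)"
    and s2: "summable (\<lambda>h. \<bar>\<gamma> (int h) * r (- k + real h)\<bar>)"
  shows "gamma_z a b \<sigma> d k = (\<Sum>h. \<gamma> (int h) * r (k + real h)) + (\<Sum>h. \<gamma> (int h) * r (- k + real h))
           - \<gamma> 0 * r k"
proof -
  have sym: "r (- k) = r k"
    using assms(1) r_minus_1 by auto
  have npi: "- d + k \<notin> \<int>\<^sub>\<le>\<^sub>0" "1 + d + k \<notin> \<int>\<^sub>\<le>\<^sub>0" "1 + d - k \<notin> \<int>\<^sub>\<le>\<^sub>0"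
    using shifted_d_npi(2)[of k] shifted_d_npi(1)[of "1 + k"] shifted_d_npi(1)[of "1 - k"] assms(1)
    by (auto simp: algebra_simps)
  have npi': "- d - k \<notin> \<int>\<^sub>\<le>\<^sub>0"
    using shifted_d_npi(2)[of "- k"] assms(1) by auto
  have nz: "r k \<noteq> 0"
    using npi d_bounds minus_d_npi not_nonpos_Ints[of "1 + d"] not_nonpos_Ints[of "1 + 2 * d"]
    by (simp add: frac_autocov_def Gamma_eq_zero_iff)
  have B: "Beta a b > 0"
    using a_pos b_gt_1 by (simp add: Beta_real_pos)
  note S1 = csa_frac_autocov_suminf[OF a_pos b_gt_1 sigma_pos npi(1,2) nz s1]
  have "- d + - k \<notin> \<int>\<^sub>\<le>\<^sub>0" "1 + d + - k \<notin> \<int>\<^sub>\<le>\<^sub>0" "r (- k) \<noteq> 0"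
    using npi npi' nz sym by simp_all
  note S2 = csa_frac_autocov_suminf[OF a_pos b_gt_1 sigma_pos this s2]
  have g0: "\<gamma> 0 = \<sigma>\<^sup>2 * Beta a (b - 1) / Beta a b"
    by (simp add: csa_autocov_def)
  show ?thesis
    unfolding S1 S2 g0 gamma_z_def gamma_star_eq F1_def F2_def sym
    using B by (simp add: field_simps)
qed

lemma toeplitz_limit:
  fixes k :: nat
  assumes "k = 0 \<or> k = 1"
  shows "(\<lambda>n. \<Sum>i<n. \<Sum>j<n. \<pi> i * \<pi> j * \<gamma> (int k + (int j - int i))) \<longlonglongrightarrow> gamma_z a b \<sigma> d (real k)"
proof -
  obtain Q where Q: "\<And>h. (\<Sum>i. \<bar>\<pi> i * \<pi> (i + h)\<bar>) \<le> Q h" "\<And>h. \<bar>r (real h)\<bar> \<le> Q h"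
    "\<And>h. Q h \<ge> 0" "\<And>h. Q (Suc h) \<le> Q h" "summable (\<lambda>h. \<gamma> (int h) * Q h)"
    by (rule domination) (rule that)
  note pos = csa_autocov_pos[OF a_pos b_gt_1 sigma_pos]
  note mono = csa_autocov_antimono[OF a_pos b_gt_1]
  define R where "R h = (\<Sum>i. \<bar>\<pi> i * \<pi> (i + h)\<bar>)" for h
  have p: "summable (\<lambda>i. \<bar>\<pi> i * \<pi> (i + h)\<bar>)" for h
    using d_bounds minus_d_npi by (intro frac_diff_coeff_prod_abs_summable) auto
  have R0: "R h \<ge> 0" for h
    unfolding R_def by (intro suminf_nonneg p) simp
  have RQ: "R h \<le> Q h" for h
    unfolding R_def by (rule Q(1))
  have rR: "\<bar>r (real h)\<bar> \<le> Q h" for h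
    by (rule Q(2))
  have dom: "summable f" if "\<And>h. \<bar>f h\<bar> \<le> \<gamma> (int h) * Q h" for f :: "nat \<Rightarrow> real"
    by (rule summable_comparison_test'[OF Q(5), where N = 0]) (simp add: that)
  have Qn: "Q (n + k) \<le> Q n" for n
    using assms Q(4)[of n] by (elim disjE) simp_all
  have gn: "\<gamma> (int k + int n) \<le> \<gamma> (int n)" for n
    by (rule mono) auto
  \<comment> \<open>Bounds for the nonnegative and the negative half of the two-sided series. In
    both halves the shift by \<open>k \<le> 1\<close> leaves \<open>\<gamma>\<close> at a lag of absolute value at least \<open>n\<close>.\<close>
  have b1: "\<bar>\<gamma> (int k + int n)\<bar> * X \<le> \<gamma> (int n) * Q n" if "0 \<le> X" "X \<le> Q n" for n X
    using that gn[of n] pos[of "int k + int n"] pos[of "int n"] by (intro mult_mono) auto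
  have b2: "\<bar>\<gamma> (int k + (- int n - 1))\<bar> * X \<le> \<gamma> (int n) * Q n" if "0 \<le> X" "X \<le> Q (n + 1)" for n X
  proof -
    have "\<gamma> (int k + (- int n - 1)) \<le> \<gamma> (int n)"
      using assms by (intro mono) auto
    then show ?thesis
      using that Q(4)[of n] pos[of "int k + (- int n - 1)"] pos[of "int n"] by (intro mult_mono) auto
  qed
  have na: "nat \<bar>- int n - 1\<bar> = n + 1" for n by simp
  have "(\<lambda>m. \<bar>\<gamma> (int k + m)\<bar> * R (nat \<bar>m\<bar>)) summable_on UNIV"
  proof (rule has_sum_imp_summable[OF has_sum_int_halves])
    show "summable (\<lambda>n. \<bar>\<bar>\<gamma> (int k + int n)\<bar> * R (nat \<bar>int n\<bar>)\<bar>)"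
      using b1[OF R0 RQ] by (intro dom) (simp add: R0 abs_mult)
    show "summable (\<lambda>n. \<bar>\<bar>\<gamma> (int k + (- int n - 1))\<bar> * R (nat \<bar>- int n - 1\<bar>)\<bar>)"
      unfolding na using b2[OF R0 RQ] by (intro dom) (simp only: R0 abs_mult abs_idempotent abs_of_nonneg)
  qed
  moreover
  have s1: "summable (\<lambda>n. \<bar>\<gamma> (int k + int n) * r (nat \<bar>int n\<bar>)\<bar>)"
    using b1[OF abs_ge_zero rR] by (intro dom) (simp add: abs_mult)
  have s2: "summable (\<lambda>n. \<bar>\<gamma> (int k + (- int n - 1)) * r (nat \<bar>- int n - 1\<bar>)\<bar>)"
    unfolding na using b2[OF abs_ge_zero rR] by (intro dom) (simp only: abs_mult abs_idempotent)
  have "((\<lambda>m. \<gamma> (int k + m) * r (nat \<bar>m\<bar>)) has_sum gamma_z a b \<sigma> d (real k)) UNIV"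
  proof -
    have t1: "summable (\<lambda>h. \<bar>\<gamma> (int h) * r (real k + real h)\<bar>)"
    proof (rule dom)
      fix h
      have "\<bar>r (real (h + k))\<bar> \<le> Q h"
        using rR[of "h + k"] Qn[of h] by linarith
      then show "\<bar>\<bar>\<gamma> (int h) * r (real k + real h)\<bar>\<bar> \<le> \<gamma> (int h) * Q h"
        using pos[of "int h"] by (simp add: abs_mult add.commute)
    qed
    have t2: "summable (\<lambda>h. \<bar>\<gamma> (int h) * r (- real k + real h)\<bar>)"
    proof -
      have "summable (\<lambda>h. \<bar>\<gamma> (int (h + k)) * r (- real k + real (h + k))\<bar>)"
        using s1 by (simp add: add.commute)
      then show ?thesis
        by (rule summable_iff_shift[THEN iffD1])
    qed
    have gz: "gamma_z a b \<sigma> d (real k) =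
        (\<Sum>h. \<gamma> (int h) * r (real k + real h)) + (\<Sum>h. \<gamma> (int h) * r (- real k + real h)) - \<gamma> 0 * r (real k)"
      using assms by (intro gamma_z_eq t1 t2) auto
    have "(\<Sum>n. \<gamma> (int k + int n) * r (nat \<bar>int n\<bar>)) + (\<Sum>n. \<gamma> (int k + (- int n - 1)) * r (nat \<bar>- int n - 1\<bar>))
        = gamma_z a b \<sigma> d (real k)"
    proof (cases "k = 0")
      case True
      have "(\<Sum>n. \<gamma> (- int n - 1) * r (real (n + 1))) = (\<Sum>n. \<gamma> (int (Suc n)) * r (real (Suc n)))"
      proof (rule suminf_cong)
        fix n
        have "- int n - 1 = - int (Suc n)" by simp
        then show "\<gamma> (- int n - 1) * r (real (n + 1)) = \<gamma> (int (Suc n)) * r (real (Suc n))"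
          by (simp only: csa_autocov_minus Suc_eq_plus1)
      qed
      also have "\<dots> = (\<Sum>n. \<gamma> (int n) * r (real n)) - \<gamma> 0 * r 0"
        using True suminf_split_head[OF summable_rabs_cancel[OF t1]] by simp
      finally show ?thesis
        using True gz unfolding na by simp
    next
      case False
      then have k: "k = 1" using assms by simp
      have "(\<Sum>n. \<gamma> (int k + (- int n - 1)) * r (real (n + 1))) = (\<Sum>h. \<gamma> (int h) * r (real k + real h))"
        by (simp add: k csa_autocov_minus add.commute)
      moreover have "(\<Sum>n. \<gamma> (int k + int n) * r (real n)) = (\<Sum>h. \<gamma> (int h) * r (- real k + real h)) - \<gamma> 0 * r (real k)"
        using k suminf_split_head[OF summable_rabs_cancel[OF t2]] r_minus_1 by simp
      ultimately show ?thesis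
        using gz unfolding na by simp
    qed
    with has_sum_int_halves[OF s1 s2] show ?thesis by simp
  qed
  ultimately show ?thesis
    unfolding R_def
    by (rule toeplitz_double_series[OF p frac_diff_coeff_prod_sums[OF d_bounds(1) minus_d_npi]])
qed

lemma r_pos:
  assumes "d < 0"
  shows "r (real h) > 0"
  using assms d_bounds
  by (simp add: frac_autocov_def zero_less_mult_iff zero_less_divide_iff add_pos_nonneg)

lemma r_neg:
  assumes "d > 0" "h > 0"
  shows "r (real h) < 0"
proof -
  have "Gamma (1 - d) = - d * Gamma (- d)"
    using Gamma_plus1[OF minus_d_npi] by simp
  moreover have "Gamma (1 - d) > 0"
    using d_bounds by simp
  ultimately have "Gamma (- d) < 0"
    using assms(1) by (simp add: mult_less_0_iff)
  moreover have "- d + real h > 0"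
    using d_bounds assms(2) by (cases h) auto
  then have "Gamma (- d + real h) > 0"
    by simp
  moreover have "Gamma (1 + d + real h) > 0" "Gamma (1 + 2 * d) > 0" "Gamma (1 + d) > 0"
    using assms(1) by (auto intro!: Gamma_real_pos add_pos_nonneg)
  ultimately show ?thesis
    unfolding frac_autocov_def
    by (intro mult_neg_pos divide_pos_neg divide_pos_pos mult_neg_pos)
qed

text \<open>
  For \<open>d < 0\<close> every summand is positive. For \<open>d > 0\<close> the autocorrelations of the weights at
  nonzero lags are negative, but their two-sided partial sums are positive, and the
  autocovariances of the aggregate are largest at lag zero.
\<close>
lemma gamma_z_0_pos: "gamma_z a b \<sigma> d 0 > 0"
proof -
  obtain Q where Q: "\<And>h. (\<Sum>i. \<bar>\<pi> i * \<pi> (i + h)\<bar>) \<le> Q h" "\<And>h. \<bar>r (real h)\<bar> \<le> Q h"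
    "\<And>h. Q h \<ge> 0" "\<And>h. Q (Suc h) \<le> Q h" "summable (\<lambda>h. \<gamma> (int h) * Q h)"
    by (rule domination) (rule that)
  note pos = csa_autocov_pos[OF a_pos b_gt_1 sigma_pos]
  let ?f = "\<lambda>h. \<gamma> (int h) * r (real h)"
  have s: "summable (\<lambda>h. \<bar>?f h\<bar>)"
  proof (rule summable_comparison_test'[OF Q(5), where N = 0])
    show "norm \<bar>?f h\<bar> \<le> \<gamma> (int h) * Q h" for h
      using pos[of "int h"] Q(2)[of h] by (simp add: abs_mult)
  qed
  have "gamma_z a b \<sigma> d 0 = 2 * suminf ?f - \<gamma> 0 * r 0"
    using gamma_z_eq[of 0] s by simp
  also have "suminf ?f = \<gamma> 0 * r 0 + (\<Sum>h. ?f (Suc h))"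
    using suminf_split_head[OF summable_rabs_cancel[OF s]] by simp
  finally have gz: "gamma_z a b \<sigma> d 0 = \<gamma> 0 * r 0 + 2 * (\<Sum>h. ?f (Suc h))"
    by simp
  have s': "summable (\<lambda>h. ?f (Suc h))"
    using summable_rabs_cancel[OF s] by (subst summable_Suc_iff)
  show ?thesis
  proof (cases "d < 0")
    case True
    have f: "?f h > 0" for h
      using pos r_pos[OF True] by simp
    have "(\<Sum>h. ?f (Suc h)) \<ge> 0"
      by (intro suminf_nonneg s' less_imp_le f)
    then show ?thesis
      unfolding gz using f[of 0] by simp
  next
    case False
    then have d: "d > 0"
      using d_bounds by simp
    \<comment> \<open>A positive lower bound for all partial sums that reach lag \<open>2\<close>. Lag \<open>2\<close> is the first at which
      the functional equation of the Beta function gives \<open>\<gamma> h < \<gamma> 0\<close>.\<close>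
    define \<delta> where "\<delta> = 2 * ((\<gamma> 2 - \<gamma> 0) * r 2)"
    have "\<gamma> 2 < \<gamma> 0"
    proof -
      have "(a + (b - 1)) * Beta (a + 1) (b - 1) = a * Beta a (b - 1)"
        using a_pos by (intro Beta_plus1_left) (auto dest: nonpos_Ints_nonpos)
      also have "\<dots> < (a + (b - 1)) * Beta a (b - 1)"
        using a_pos b_gt_1 by (simp add: Beta_real_pos)
      finally have "Beta (a + 1) (b - 1) < Beta a (b - 1)"
        using a_pos b_gt_1 by simp
      moreover have "Beta a b > 0"
        using a_pos b_gt_1 by (simp add: Beta_real_pos)
      ultimately show ?thesis
        using sigma_pos by (simp add: csa_autocov_def divide_strict_right_mono)
    qed
    then have "\<delta> > 0"
      using r_neg[OF d, of 2] by (simp add: \<delta>_def mult_neg_neg)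
    have "\<delta> \<le> \<gamma> 0 * r 0 + 2 * (\<Sum>h<n. ?f (Suc h))" if "n \<ge> 2" for n
    proof -
      have "(\<Sum>h\<in>{1}. (\<gamma> (int (Suc h)) - \<gamma> 0) * r (real (Suc h)))
          \<le> (\<Sum>h<n. (\<gamma> (int (Suc h)) - \<gamma> 0) * r (real (Suc h)))"
      proof (rule sum_mono2)
        fix h
        have "\<gamma> (int (Suc h)) \<le> \<gamma> 0"
          by (rule csa_autocov_antimono[OF a_pos b_gt_1]) simp
        then show "(\<gamma> (int (Suc h)) - \<gamma> 0) * r (real (Suc h)) \<ge> 0"
          using r_neg[OF d, of "Suc h"] by (intro mult_nonpos_nonpos) auto
      qed (use that in auto)
      moreover have "(\<Sum>h<n. (\<gamma> (int (Suc h)) - \<gamma> 0) * r (real (Suc h)))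
          = (\<Sum>h<n. ?f (Suc h)) - \<gamma> 0 * (\<Sum>h<n. r (real (Suc h)))"
        by (simp only: left_diff_distrib sum_subtractf sum_distrib_left)
      moreover have "r 0 + 2 * (\<Sum>h<n. r (real (Suc h))) > 0"
      proof -
        have "(\<Sum>h<n. r (real (Suc h))) = (\<Sum>h=1..n. r (real h))"
          by (rule sum.reindex_bij_witness[of _ "\<lambda>h. h - 1" Suc]) auto
        moreover have "Gamma (1 + 2 * d) > 0" "Gamma (1 - d) > 0" "Gamma (1 + d) > 0"
          "Gamma (real n + 1 - d) > 0" "Gamma (real n + 1 + d) > 0"
          using d d_bounds by (auto intro!: Gamma_real_pos)
        ultimately show ?thesis
          using sum_frac_autocov[of d n] d d_bounds by simp
      qed
      then have "\<gamma> 0 * r 0 + 2 * (\<gamma> 0 * (\<Sum>h<n. r (real (Suc h)))) \<ge> 0"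
        using mult_pos_pos[OF pos[of 0], of "r 0 + 2 * (\<Sum>h<n. r (real (Suc h)))"]
        by (simp only: distrib_left mult.left_commute[of "\<gamma> 0" 2] less_imp_le)
      ultimately show ?thesis
        by (simp add: \<delta>_def)
    qed
    moreover have "(\<lambda>n. \<gamma> 0 * r 0 + 2 * (\<Sum>h<n. ?f (Suc h))) \<longlonglongrightarrow> gamma_z a b \<sigma> d 0"
      unfolding gz by (intro tendsto_intros summable_LIMSEQ s')
    ultimately have "\<delta> \<le> gamma_z a b \<sigma> d 0"
      by (intro LIMSEQ_le_const) auto
    with \<open>\<delta> > 0\<close> show ?thesis by simp
  qed
qed

end

section \<open>Moments of the random coefficients\<close>

text \<open>
  The density of \<open>\<alpha>\<^sup>2\<close> multiplied by \<open>u powr s\<close> is again an unnormalised Beta density, with \<open>a + s\<close> in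
  place of \<open>a\<close>.
\<close>

lemma Beta_density_moment:
  fixes a b s :: real
  assumes "a > 0" "b > 0" "s \<ge> 0"
  defines "f \<equiv> \<lambda>u. indicator {0<..<1} u * (1 / Beta a b * u powr (a - 1) * (1 - u) powr (b - 1)) * u powr s"
  shows "integrable lborel f" "(\<integral>u. f u \<partial>lborel) = Beta (a + s) b / Beta a b"
proof -
  define g where "g = (\<lambda>u::real. u powr (a + s - 1) * (1 - u) powr (b - 1))"
  have s: "set_integrable lborel {0..1} g"
    unfolding g_def using assms by (intro integrable_Beta) auto
  have I: "(LINT u:{0..1}|lborel. g u) = Beta (a + s) b"
    using set_borel_integral_eq_integral(2)[OF s] has_integral_Beta_real[of "a + s" b] assms
    by (simp add: g_def integral_unique)
  have eq: "AE u in lborel. 1 / Beta a b * (indicator {0..1} u *\<^sub>R g u) = f u"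
  proof -
    have "AE u in lborel. u \<noteq> (0::real)" "AE u in lborel. u \<noteq> (1::real)"
      by (rule AE_lborel_singleton)+
    then show ?thesis
    proof eventually_elim
      case (elim u)
      then show ?case
        by (auto simp: f_def g_def indicator_def powr_add[symmetric] algebra_simps)
    qed
  qed
  have int: "integrable lborel (\<lambda>u. 1 / Beta a b * (indicator {0..1} u *\<^sub>R g u))"
    using s unfolding set_integrable_def by (rule integrable_mult_right)
  have [measurable]: "f \<in> borel_measurable lborel"
    unfolding f_def by measurable
  show "integrable lborel f"
    using int by (rule integrable_cong_AE_imp) (use eq in \<open>auto elim: eventually_mono\<close>)
  have "(\<integral>u. f u \<partial>lborel) = (\<integral>u. 1 / Beta a b * (indicator {0..1} u *\<^sub>R g u) \<partial>lborel)"
    using eq borel_measurable_integrable[OF int] by (intro integral_cong_AE) (auto elim: eventually_mono)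
  also have "\<dots> = 1 / Beta a b * Beta (a + s) b"
    unfolding I[symmetric] set_lebesgue_integral_def by (rule integral_mult_right_zero)
  finally show "(\<integral>u. f u \<partial>lborel) = Beta (a + s) b / Beta a b"
    by simp
qed

lemma Beta_asymp_0:
  fixes x w :: real
  assumes "x > 0" "w > 0"
  shows "(\<lambda>n. Beta (x + real n) w) \<longlonglongrightarrow> 0"
proof -
  have "x + w \<notin> \<int>\<^sub>\<le>\<^sub>0"
    using assms by (auto dest: nonpos_Ints_nonpos)
  from pochhammer_quotient_le[OF this, of x] obtain K where K: "K > 0"
    "\<And>n. \<bar>pochhammer x n / pochhammer (x + w) n\<bar> \<le> K * (real n + 1) powr (x - (x + w))" by metis
  have "(\<lambda>n. K * (real n + 1) powr (- w)) \<longlonglongrightarrow> 0"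
    using assms K(1) by real_asymp
  then have "(\<lambda>n. pochhammer x n / pochhammer (x + w) n) \<longlonglongrightarrow> 0"
    by (rule Lim_null_comparison[rotated]) (use K(2) in \<open>auto intro!: always_eventually\<close>)
  from tendsto_mult_left_zero[OF this, of "Beta x w"] show ?thesis
    using assms by (simp add: Beta_add_nat mult.commute)
qed

lemma Beta_telescope:
  fixes x w :: real
  assumes "x > 0" "w > 0"
  shows "(\<lambda>j. Beta (x + real j) (w + 1)) sums Beta x w"
proof -
  have "Beta (x + real j) (w + 1) = Beta (x + real j) w - Beta (x + real (Suc j)) w" for j
  proof -
    have "x + real j > 0"
      using assms by simp
    then have "x + real j \<notin> \<int>\<^sub>\<le>\<^sub>0" "w \<notin> \<int>\<^sub>\<le>\<^sub>0"
      using assms nonpos_Ints_nonpos[of w] nonpos_Ints_nonpos[of "x + real j"] by linarith+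
    from Beta_plus1_plus1[OF this] show ?thesis
      by (simp add: algebra_simps)
  qed
  then show ?thesis
    using telescope_sums'[OF Beta_asymp_0[OF assms]] by simp
qed

text \<open>
  The moment \<open>E(\<alpha>\<^sup>m)\<close>, which is the moment of order \<open>m / 2\<close> of the Beta distribution of \<open>\<alpha>\<^sup>2\<close>.
\<close>

definition coeff_moment :: "real \<Rightarrow> real \<Rightarrow> nat \<Rightarrow> real" where
  "coeff_moment a b m = Beta (a + real m / 2) b / Beta a b"

lemma coeff_moment_nonneg: "a > 0 \<Longrightarrow> b > 0 \<Longrightarrow> coeff_moment a b m \<ge> 0"
  by (simp add: coeff_moment_def Beta_real_pos less_imp_le add_pos_nonneg)

text \<open>
  The series is \<open>\<sigma>\<^sup>2 E(\<alpha>\<^sup>h / (1 - \<alpha>\<^sup>2))\<close> with the geometric series expanded. No integral against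
  \<open>1 / (1 - u)\<close> has to be evaluated, because the moments telescope.
\<close>

lemma coeff_moment_sums:
  assumes "a > 0" "b > 1"
  shows "(\<lambda>j. \<sigma>\<^sup>2 * coeff_moment a b (2 * j + h)) sums csa_autocov a b \<sigma> (int h)"
proof -
  have "(\<lambda>j. \<sigma>\<^sup>2 / Beta a b * Beta (a + real h / 2 + real j) (b - 1 + 1)) sums
      (\<sigma>\<^sup>2 / Beta a b * Beta (a + real h / 2) (b - 1))"
    using assms by (intro sums_mult Beta_telescope) auto
  moreover have "a + real (2 * j + h) / 2 = a + real h / 2 + real j" for j
    by (simp add: field_simps)
  then have "coeff_moment a b (2 * j + h) = Beta (a + real h / 2 + real j) (b - 1 + 1) / Beta a b" for j
    by (simp only: coeff_moment_def diff_add_cancel)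
  ultimately show ?thesis
    by (simp add: csa_autocov_def)
qed

lemma summable_coeff_moment:
  assumes "a > 0" "b > 1"
  shows "summable (coeff_moment a b)"
proof -
  have "summable (\<lambda>j. coeff_moment a b (2 * j + h))" for h
    using sums_summable[OF coeff_moment_sums[OF assms, of 1 h]] by simp
  from this[of 0] this[of 1]
  have "(\<lambda>n. if even n then coeff_moment a b (2 * (n div 2)) else coeff_moment a b (2 * ((n - 1) div 2) + 1))
      sums ((\<Sum>j. coeff_moment a b (2 * j + 1)) + (\<Sum>j. coeff_moment a b (2 * j)))"
    by (intro sums_if summable_sums) simp_all
  moreover have "(\<lambda>n. if even n then coeff_moment a b (2 * (n div 2)) else coeff_moment a b (2 * ((n - 1) div 2) + 1))
     = coeff_moment a b"
    by (auto simp: fun_eq_iff elim!: oddE)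
  ultimately show ?thesis by (simp add: sums_iff)
qed

section \<open>Mean-square limits\<close>

lemma square_integrable_mult:
  fixes f g :: "'a \<Rightarrow> real"
  assumes [measurable]: "f \<in> borel_measurable M" "g \<in> borel_measurable M"
    and "integrable M (\<lambda>x. (f x)\<^sup>2)" "integrable M (\<lambda>x. (g x)\<^sup>2)"
  shows "integrable M (\<lambda>x. f x * g x)"
proof (rule Bochner_Integration.integrable_bound)
  show "integrable M (\<lambda>x. (f x)\<^sup>2 + (g x)\<^sup>2)"
    using assms by simp
  have "\<bar>u * v\<bar> \<le> \<bar>u\<^sup>2 + v\<^sup>2\<bar>" for u v :: real
  proof -
    have "0 \<le> (\<bar>u\<bar> - \<bar>v\<bar>)\<^sup>2" by simp
    then have "2 * (\<bar>u\<bar> * \<bar>v\<bar>) \<le> u\<^sup>2 + v\<^sup>2" by (simp add: power2_diff)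
    moreover have "0 \<le> \<bar>u\<bar> * \<bar>v\<bar>" by simp
    ultimately have "\<bar>u\<bar> * \<bar>v\<bar> \<le> u\<^sup>2 + v\<^sup>2" by linarith
    then show ?thesis by (simp add: abs_mult)
  qed
  then show "AE x in M. norm (f x * g x) \<le> norm ((f x)\<^sup>2 + (g x)\<^sup>2)"
    by simp
qed measurable

lemma square_integrable_diff:
  fixes f g :: "'a \<Rightarrow> real"
  assumes "f \<in> borel_measurable M" "g \<in> borel_measurable M"
    and "integrable M (\<lambda>x. (f x)\<^sup>2)" "integrable M (\<lambda>x. (g x)\<^sup>2)"
  shows "integrable M (\<lambda>x. (f x - g x)\<^sup>2)"
  using square_integrable_mult[OF assms] assms
  by (simp add: power2_diff mult.assoc)

lemma square_integrable_sum:
  fixes f :: "'i \<Rightarrow> 'a \<Rightarrow> real"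
  assumes "finite I" "\<And>i. i \<in> I \<Longrightarrow> f i \<in> borel_measurable M" "\<And>i. i \<in> I \<Longrightarrow> integrable M (\<lambda>x. (f i x)\<^sup>2)"
  shows "integrable M (\<lambda>x. (\<Sum>i\<in>I. f i x)\<^sup>2)"
  unfolding power2_eq_square sum_product
  using assms by (intro Bochner_Integration.integrable_sum square_integrable_mult) (auto simp: power2_eq_square)

lemma integral_mult_squared_le:
  fixes f g :: "'a \<Rightarrow> real"
  assumes "f \<in> borel_measurable M" "g \<in> borel_measurable M"
    and f: "integrable M (\<lambda>x. (f x)\<^sup>2)" and g: "integrable M (\<lambda>x. (g x)\<^sup>2)"
  shows "(\<integral>x. f x * g x \<partial>M)\<^sup>2 \<le> (\<integral>x. (f x)\<^sup>2 \<partial>M) * (\<integral>x. (g x)\<^sup>2 \<partial>M)"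
proof -
  note fg = square_integrable_mult[OF assms]
  define A B C where "A = (\<integral>x. (f x)\<^sup>2 \<partial>M)" and "B = (\<integral>x. f x * g x \<partial>M)" and "C = (\<integral>x. (g x)\<^sup>2 \<partial>M)"
  have q: "0 \<le> A - 2 * c * B + c\<^sup>2 * C" for c
  proof -
    have "0 \<le> (\<integral>x. (f x - c * g x)\<^sup>2 \<partial>M)"
      by (rule integral_nonneg_AE) simp
    also have "\<dots> = (\<integral>x. (f x)\<^sup>2 - 2 * c * (f x * g x) + c\<^sup>2 * (g x)\<^sup>2 \<partial>M)"
      by (rule Bochner_Integration.integral_cong) (simp_all add: power2_diff power_mult_distrib mult_ac)
    also have "\<dots> = A - 2 * c * B + c\<^sup>2 * C"
      using f g fg by (simp add: A_def B_def C_def)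
    finally show ?thesis .
  qed
  have C0: "C \<ge> 0" "A \<ge> 0"
    unfolding A_def C_def by (rule integral_nonneg_AE, simp)+
  show ?thesis
    unfolding A_def[symmetric] B_def[symmetric] C_def[symmetric]
  proof (cases "C = 0")
    case True
    \<comment> \<open>With \<open>C = 0\<close> the polynomial in \<open>c\<close> is affine; the chosen point is where it equals \<open>- 1\<close>.\<close>
    have "B = 0"
    proof (rule ccontr)
      assume "B \<noteq> 0"
      then show False
        using q[of "(A + 1) / (2 * B)"] True by (simp add: field_simps)
    qed
    then show "B\<^sup>2 \<le> A * C" using True by simp
  next
    case False
    then have "C > 0" using C0 by simp
    then show "B\<^sup>2 \<le> A * C"
      using q[of "B / C"] by (simp add: field_simps power2_eq_square)
  qed
qed

text \<open>
  Expand \<open>S\<^sub>n T\<^sub>n\<close> around \<open>Z W\<close>; each of the three error terms is controlled by the Cauchy-Schwarz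
  inequality.
\<close>

lemma mean_square_limit_mult:
  assumes S: "mean_square_limit M S Z" and T: "mean_square_limit M T W"
  shows "(\<lambda>n. \<integral>\<omega>. S n \<omega> * T n \<omega> \<partial>M) \<longlonglongrightarrow> (\<integral>\<omega>. Z \<omega> * W \<omega> \<partial>M)"
proof -
  note m = S[unfolded mean_square_limit_def] T[unfolded mean_square_limit_def]
  have [measurable]: "S n \<in> borel_measurable M" "T n \<in> borel_measurable M"
    "Z \<in> borel_measurable M" "W \<in> borel_measurable M" for n
    using m by auto
  have sq: "integrable M (\<lambda>\<omega>. (S n \<omega>)\<^sup>2)" "integrable M (\<lambda>\<omega>. (T n \<omega>)\<^sup>2)"
    "integrable M (\<lambda>\<omega>. (Z \<omega>)\<^sup>2)" "integrable M (\<lambda>\<omega>. (W \<omega>)\<^sup>2)"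
    "integrable M (\<lambda>\<omega>. (S n \<omega> - Z \<omega>)\<^sup>2)" "integrable M (\<lambda>\<omega>. (T n \<omega> - W \<omega>)\<^sup>2)" for n
    using m by (auto intro!: square_integrable_diff)
  define s t where "s n = (\<integral>\<omega>. (S n \<omega> - Z \<omega>)\<^sup>2 \<partial>M)" and "t n = (\<integral>\<omega>. (T n \<omega> - W \<omega>)\<^sup>2 \<partial>M)" for n
  have lim: "s \<longlonglongrightarrow> 0" "t \<longlonglongrightarrow> 0"
    using m by (simp_all add: s_def[abs_def] t_def[abs_def])
  define P1 P2 P3 where "P1 n = (\<integral>\<omega>. (S n \<omega> - Z \<omega>) * (T n \<omega> - W \<omega>) \<partial>M)"
    and "P2 n = (\<integral>\<omega>. (S n \<omega> - Z \<omega>) * W \<omega> \<partial>M)"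
    and "P3 n = (\<integral>\<omega>. Z \<omega> * (T n \<omega> - W \<omega>) \<partial>M)" for n
  have to0: "P \<longlonglongrightarrow> 0" if "\<And>n. (P n)\<^sup>2 \<le> e n" "e \<longlonglongrightarrow> 0" for P e :: "nat \<Rightarrow> real"
  proof -
    have "(\<lambda>n. (P n)\<^sup>2) \<longlonglongrightarrow> 0"
      by (rule tendsto_sandwich[OF _ _ tendsto_const that(2)]) (use that(1) in auto)
    then have "(\<lambda>n. sqrt ((P n)\<^sup>2)) \<longlonglongrightarrow> sqrt 0"
      by (rule tendsto_real_sqrt)
    then show ?thesis
      by (simp add: tendsto_rabs_zero_iff)
  qed
  have "P1 \<longlonglongrightarrow> 0"
  proof (rule to0)
    show "(P1 n)\<^sup>2 \<le> s n * t n" for n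
      unfolding P1_def s_def t_def by (intro integral_mult_squared_le sq) measurable
    show "(\<lambda>n. s n * t n) \<longlonglongrightarrow> 0"
      using tendsto_mult[OF lim] by simp
  qed
  moreover have "P2 \<longlonglongrightarrow> 0"
  proof (rule to0)
    show "(P2 n)\<^sup>2 \<le> s n * (\<integral>\<omega>. (W \<omega>)\<^sup>2 \<partial>M)" for n
      unfolding P2_def s_def by (intro integral_mult_squared_le sq) measurable
    show "(\<lambda>n. s n * (\<integral>\<omega>. (W \<omega>)\<^sup>2 \<partial>M)) \<longlonglongrightarrow> 0"
      using lim(1) by (rule tendsto_mult_left_zero)
  qed
  moreover have "P3 \<longlonglongrightarrow> 0"
  proof (rule to0)
    show "(P3 n)\<^sup>2 \<le> (\<integral>\<omega>. (Z \<omega>)\<^sup>2 \<partial>M) * t n" for n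
      unfolding P3_def t_def by (intro integral_mult_squared_le sq) measurable
    show "(\<lambda>n. (\<integral>\<omega>. (Z \<omega>)\<^sup>2 \<partial>M) * t n) \<longlonglongrightarrow> 0"
      using lim(2) by (rule tendsto_mult_right_zero)
  qed
  ultimately have "(\<lambda>n. P1 n + P2 n + P3 n + (\<integral>\<omega>. Z \<omega> * W \<omega> \<partial>M)) \<longlonglongrightarrow> 0 + 0 + 0 + (\<integral>\<omega>. Z \<omega> * W \<omega> \<partial>M)"
    by (intro tendsto_intros)
  moreover have "P1 n + P2 n + P3 n + (\<integral>\<omega>. Z \<omega> * W \<omega> \<partial>M) = (\<integral>\<omega>. S n \<omega> * T n \<omega> \<partial>M)" for n
  proof -
    have i: "integrable M (\<lambda>\<omega>. (S n \<omega> - Z \<omega>) * (T n \<omega> - W \<omega>))" "integrable M (\<lambda>\<omega>. (S n \<omega> - Z \<omega>) * W \<omega>)"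
      "integrable M (\<lambda>\<omega>. Z \<omega> * (T n \<omega> - W \<omega>))" "integrable M (\<lambda>\<omega>. Z \<omega> * W \<omega>)"
      by (intro square_integrable_mult sq; measurable)+
    have "(\<integral>\<omega>. S n \<omega> * T n \<omega> \<partial>M) = (\<integral>\<omega>. (S n \<omega> - Z \<omega>) * (T n \<omega> - W \<omega>) + (S n \<omega> - Z \<omega>) * W \<omega>
        + Z \<omega> * (T n \<omega> - W \<omega>) + Z \<omega> * W \<omega> \<partial>M)"
      by (rule Bochner_Integration.integral_cong) (simp_all add: algebra_simps)
    also have "\<dots> = P1 n + P2 n + P3 n + (\<integral>\<omega>. Z \<omega> * W \<omega> \<partial>M)"
      unfolding P1_def P2_def P3_def
      by (simp only: Bochner_Integration.integral_add Bochner_Integration.integrable_add i)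
    finally show ?thesis by simp
  qed
  ultimately show ?thesis by simp
qed

lemma (in prob_space) mean_square_limit_expectation:
  assumes S: "mean_square_limit M S Z"
  shows "(\<lambda>n. expectation (S n)) \<longlonglongrightarrow> expectation Z"
proof -
  have "mean_square_limit M (\<lambda>_ _. 1) (\<lambda>_. 1)"
    by (simp add: mean_square_limit_def)
  from mean_square_limit_mult[OF S this] show ?thesis by simp
qed

section \<open>The stationary solution of the random-coefficient recursion\<close>

locale panel = prob_space P for P :: "'a measure" +
  fixes \<alpha> :: "nat \<Rightarrow> 'a \<Rightarrow> real" and \<epsilon> y :: "nat \<Rightarrow> int \<Rightarrow> 'a \<Rightarrow> real" and a b \<sigma> :: real
  assumes a_pos: "a > 0" and b_gt_1: "b > 1" and sigma_pos: "\<sigma> > 0"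
    and ar1_panel: "ar1_panel P \<alpha> \<epsilon> y a b \<sigma>"
begin

definition noise :: "nat + nat \<times> int \<Rightarrow> 'a \<Rightarrow> real" where
  "noise k = (case k of Inl i \<Rightarrow> \<alpha> i | Inr (i, t) \<Rightarrow> \<epsilon> i t)"

lemma noise_simps [simp]: "noise (Inl i) = \<alpha> i" "noise (Inr (i, t)) = \<epsilon> i t"
  by (simp_all add: noise_def)

lemma indep_noise: "indep_vars (\<lambda>_. borel) noise UNIV"
  using ar1_panel by (simp add: ar1_panel_def noise_def[abs_def])

lemma measurable_noise [measurable]: "noise k \<in> borel_measurable P"
  using indep_noise by (simp add: indep_vars_def)

lemma measurable_coeff [measurable]: "\<alpha> i \<in> borel_measurable P"
  using measurable_noise[of "Inl i"] by simp

lemma measurable_innovation [measurable]: "\<epsilon> i t \<in> borel_measurable P"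
  using measurable_noise[of "Inr (i, t)"] by simp

lemma measurable_y [measurable]: "y i t \<in> borel_measurable P"
  using ar1_panel by (simp add: ar1_panel_def strictly_stationary_def)

lemma coeff_bounds: "AE \<omega> in P. 0 < \<alpha> i \<omega> \<and> \<alpha> i \<omega> < 1"
  using ar1_panel by (simp add: ar1_panel_def)

lemma recursion: "AE \<omega> in P. y i t \<omega> = \<alpha> i \<omega> * y i (t - 1) \<omega> + \<epsilon> i t \<omega>"
  using ar1_panel by (simp add: ar1_panel_def)

lemma innovation_square_integrable: "integrable P (\<lambda>\<omega>. (\<epsilon> i t \<omega>)\<^sup>2)"
  using ar1_panel by (simp add: ar1_panel_def)

lemma innovation_integrable: "integrable P (\<epsilon> i t)"
  by (rule square_integrable_imp_integrable[OF _ innovation_square_integrable]) simp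

lemma innovation_mean: "expectation (\<epsilon> i t) = 0"
  using ar1_panel by (simp add: ar1_panel_def)

lemma innovation_variance: "expectation (\<lambda>\<omega>. (\<epsilon> i t \<omega>)\<^sup>2) = \<sigma>\<^sup>2"
proof -
  have "variance (\<epsilon> i t) = \<sigma>\<^sup>2"
    using ar1_panel unfolding ar1_panel_def by blast
  then show ?thesis by (simp add: innovation_mean)
qed

lemma innovation_distr: "distr P borel (\<epsilon> i t) = distr P borel (\<epsilon> 0 0)"
  using ar1_panel unfolding ar1_panel_def by blast

lemma innovation_abs_mean: "expectation (\<lambda>\<omega>. \<bar>\<epsilon> i t \<omega>\<bar>) = expectation (\<lambda>\<omega>. \<bar>\<epsilon> 0 0 \<omega>\<bar>)"
  using integral_distr[of "\<epsilon> i t" P borel abs] integral_distr[of "\<epsilon> 0 0" P borel abs]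
  by (simp add: innovation_distr[of i t])

lemma coeff_square_distributed:
  "distributed P lborel (\<lambda>\<omega>. (\<alpha> i \<omega>)\<^sup>2)
     (\<lambda>u. ennreal (indicator {0<..<1} u * (1 / Beta a b * u powr (a - 1) * (1 - u) powr (b - 1))))"
  using ar1_panel by (simp add: ar1_panel_def)

lemma coeff_power:
  shows coeff_power_integrable: "integrable P (\<lambda>\<omega>. (\<alpha> i \<omega>) ^ m)"
    and coeff_power_expectation: "expectation (\<lambda>\<omega>. (\<alpha> i \<omega>) ^ m) = coeff_moment a b m"
proof -
  define f where "f u = indicator {0<..<1} u * (1 / Beta a b * u powr (a - 1) * (1 - u) powr (b - 1))" for u :: real
  have f0: "0 \<le> f u" for u
    using a_pos b_gt_1 by (simp add: f_def Beta_real_pos less_imp_le)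
  note D = coeff_square_distributed[of i, folded f_def]
  have meas: "(\<lambda>u::real. u powr (real m / 2)) \<in> borel_measurable lborel"
    by measurable
  have I: "integrable lborel (\<lambda>u. f u * u powr (real m / 2))"
    and E: "(\<integral>u. f u * u powr (real m / 2) \<partial>lborel) = coeff_moment a b m"
    using Beta_density_moment[of a b "real m / 2"] a_pos b_gt_1
    by (simp_all add: f_def coeff_moment_def mult.assoc)
  have i: "integrable P (\<lambda>\<omega>. ((\<alpha> i \<omega>)\<^sup>2) powr (real m / 2))"
    using distributed_integrable[OF D meas] f0 I by simp
  have e: "expectation (\<lambda>\<omega>. ((\<alpha> i \<omega>)\<^sup>2) powr (real m / 2)) = coeff_moment a b m"
    using distributed_integral[OF D meas] f0 E by simp
  have eq: "AE \<omega> in P. ((\<alpha> i \<omega>)\<^sup>2) powr (real m / 2) = (\<alpha> i \<omega>) ^ m"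
    using coeff_bounds[of i]
  proof eventually_elim
    case (elim \<omega>)
    then have "(\<alpha> i \<omega>)\<^sup>2 = \<alpha> i \<omega> powr 2" "(\<alpha> i \<omega>) ^ m = \<alpha> i \<omega> powr real m"
      by (simp_all add: powr_realpow)
    then show ?case
      by (simp add: powr_powr)
  qed
  show "integrable P (\<lambda>\<omega>. (\<alpha> i \<omega>) ^ m)"
    using i by (rule integrable_cong_AE_imp) (use eq in \<open>auto elim: eventually_mono\<close>)
  show "expectation (\<lambda>\<omega>. (\<alpha> i \<omega>) ^ m) = coeff_moment a b m"
    unfolding e[symmetric] using eq by (intro integral_cong_AE) (auto elim: eventually_mono)
qed

lemma coeff_abs_power:
  shows coeff_abs_power_integrable: "integrable P (\<lambda>\<omega>. \<bar>\<alpha> i \<omega>\<bar> ^ m)"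
    and coeff_abs_power_expectation: "expectation (\<lambda>\<omega>. \<bar>\<alpha> i \<omega>\<bar> ^ m) = coeff_moment a b m"
proof -
  have eq: "AE \<omega> in P. (\<alpha> i \<omega>) ^ m = \<bar>\<alpha> i \<omega>\<bar> ^ m"
    using coeff_bounds[of i] by eventually_elim simp
  show "integrable P (\<lambda>\<omega>. \<bar>\<alpha> i \<omega>\<bar> ^ m)"
    using coeff_power_integrable[of i m] by (rule integrable_cong_AE_imp) (use eq in auto)
  show "expectation (\<lambda>\<omega>. \<bar>\<alpha> i \<omega>\<bar> ^ m) = coeff_moment a b m"
    unfolding coeff_power_expectation[of i m, symmetric]
    using eq by (intro integral_cong_AE) (auto elim: eventually_mono)
qed

text \<open>
  All the independence in the panel is used through this product rule; the functions \<open>g k\<close> select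
  the powers of the coefficient and of the innovations that are needed.
\<close>

lemma noise_product:
  fixes g :: "nat + nat \<times> int \<Rightarrow> real \<Rightarrow> real"
  assumes I: "finite I" and g: "\<And>k. k \<in> I \<Longrightarrow> g k \<in> borel_measurable borel"
    and int: "\<And>k. k \<in> I \<Longrightarrow> integrable P (\<lambda>\<omega>. g k (noise k \<omega>))"
  shows "integrable P (\<lambda>\<omega>. \<Prod>k\<in>I. g k (noise k \<omega>))"
    and "expectation (\<lambda>\<omega>. \<Prod>k\<in>I. g k (noise k \<omega>)) = (\<Prod>k\<in>I. expectation (\<lambda>\<omega>. g k (noise k \<omega>)))"
proof -
  have "indep_vars (\<lambda>_. borel) (\<lambda>k \<omega>. g k (noise k \<omega>)) I"
    by (rule indep_vars_compose2[OF indep_vars_subset[OF indep_noise]]) (use g in auto)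
  from indep_vars_integrable[OF I this int] indep_vars_lebesgue_integral[OF I this int]
  show "integrable P (\<lambda>\<omega>. \<Prod>k\<in>I. g k (noise k \<omega>))"
    and "expectation (\<lambda>\<omega>. \<Prod>k\<in>I. g k (noise k \<omega>)) = (\<Prod>k\<in>I. expectation (\<lambda>\<omega>. g k (noise k \<omega>)))"
    by auto
qed

lemma coeff_innovation_abs:
  shows coeff_innovation_abs_integrable: "integrable P (\<lambda>\<omega>. \<bar>\<alpha> i \<omega>\<bar> ^ m * \<bar>\<epsilon> i t \<omega>\<bar>)"
    and coeff_innovation_abs_expectation:
      "expectation (\<lambda>\<omega>. \<bar>\<alpha> i \<omega>\<bar> ^ m * \<bar>\<epsilon> i t \<omega>\<bar>) =
        coeff_moment a b m * expectation (\<lambda>\<omega>. \<bar>\<epsilon> 0 0 \<omega>\<bar>)"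
proof -
  define I :: "(nat + nat \<times> int) set" where "I = {Inl i, Inr (i, t)}"
  define g where "g k = (case k of Inl _ \<Rightarrow> (\<lambda>x. \<bar>x\<bar> ^ m) | Inr _ \<Rightarrow> (\<lambda>x::real. \<bar>x\<bar>))" for k :: "nat + nat \<times> int"
  have I: "finite I" by (simp add: I_def)
  have meas: "g k \<in> borel_measurable borel" for k
    by (cases k) (simp_all add: g_def)
  have int: "integrable P (\<lambda>\<omega>. g k (noise k \<omega>))" if "k \<in> I" for k
    using that coeff_abs_power_integrable[of i m] innovation_integrable[of i t]
    by (auto simp: g_def I_def)
  have prod: "(\<Prod>k\<in>I. g k (noise k \<omega>)) = \<bar>\<alpha> i \<omega>\<bar> ^ m * \<bar>\<epsilon> i t \<omega>\<bar>" for \<omega>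
    by (simp add: I_def g_def)
  show "integrable P (\<lambda>\<omega>. \<bar>\<alpha> i \<omega>\<bar> ^ m * \<bar>\<epsilon> i t \<omega>\<bar>)"
    using noise_product(1)[OF I meas int] unfolding prod .
  show "expectation (\<lambda>\<omega>. \<bar>\<alpha> i \<omega>\<bar> ^ m * \<bar>\<epsilon> i t \<omega>\<bar>) =
        coeff_moment a b m * expectation (\<lambda>\<omega>. \<bar>\<epsilon> 0 0 \<omega>\<bar>)"
    using noise_product(2)[OF I meas int] unfolding prod
    by (simp add: I_def g_def coeff_abs_power_expectation innovation_abs_mean[of i t])
qed

lemma coeff_innovation:
  shows coeff_innovation_integrable: "integrable P (\<lambda>\<omega>. (\<alpha> i \<omega>) ^ m * \<epsilon> i t \<omega>)"
    and coeff_innovation_expectation: "expectation (\<lambda>\<omega>. (\<alpha> i \<omega>) ^ m * \<epsilon> i t \<omega>) = 0"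
proof -
  define I :: "(nat + nat \<times> int) set" where "I = {Inl i, Inr (i, t)}"
  define g where "g k = (case k of Inl _ \<Rightarrow> (\<lambda>x. x ^ m) | Inr _ \<Rightarrow> (\<lambda>x::real. x))" for k :: "nat + nat \<times> int"
  have I: "finite I" by (simp add: I_def)
  have meas: "g k \<in> borel_measurable borel" for k
    by (cases k) (simp_all add: g_def)
  have int: "integrable P (\<lambda>\<omega>. g k (noise k \<omega>))" if "k \<in> I" for k
    using that coeff_power_integrable[of i m] innovation_integrable[of i t]
    by (auto simp: g_def I_def)
  have prod: "(\<Prod>k\<in>I. g k (noise k \<omega>)) = (\<alpha> i \<omega>) ^ m * \<epsilon> i t \<omega>" for \<omega>
    by (simp add: I_def g_def)
  show "integrable P (\<lambda>\<omega>. (\<alpha> i \<omega>) ^ m * \<epsilon> i t \<omega>)"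
    using noise_product(1)[OF I meas int] unfolding prod .
  show "expectation (\<lambda>\<omega>. (\<alpha> i \<omega>) ^ m * \<epsilon> i t \<omega>) = 0"
    using noise_product(2)[OF I meas int] unfolding prod
    by (simp add: I_def g_def innovation_mean)
qed

lemma coeff_innovation_product:
  shows coeff_innovation_product_integrable:
      "integrable P (\<lambda>\<omega>. (\<alpha> i \<omega>) ^ m * (\<epsilon> i s \<omega> * \<epsilon> i t \<omega>))"
    and coeff_innovation_product_expectation:
      "expectation (\<lambda>\<omega>. (\<alpha> i \<omega>) ^ m * (\<epsilon> i s \<omega> * \<epsilon> i t \<omega>)) =
           (if s = t then \<sigma>\<^sup>2 * coeff_moment a b m else 0)"
proof -
  \<comment> \<open>For \<open>s = t\<close> the index set has two elements only, and the innovation enters squared.\<close>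
  define I :: "(nat + nat \<times> int) set" where "I = {Inl i, Inr (i, s), Inr (i, t)}"
  define p where "p = (if s = t then 2 else 1 :: nat)"
  define g where "g k = (case k of Inl _ \<Rightarrow> (\<lambda>x. x ^ m) | Inr _ \<Rightarrow> (\<lambda>x::real. x ^ p))" for k :: "nat + nat \<times> int"
  have I: "finite I" by (simp add: I_def)
  have meas: "g k \<in> borel_measurable borel" for k
    by (cases k) (simp_all add: g_def)
  have "integrable P (\<lambda>\<omega>. (\<epsilon> i r \<omega>) ^ p)" for r
    using innovation_integrable[of i r] innovation_square_integrable[of i r] by (simp add: p_def)
  then have int: "integrable P (\<lambda>\<omega>. g k (noise k \<omega>))" if "k \<in> I" for k
    using that coeff_power_integrable[of i m] by (auto simp: g_def I_def)
  have prod: "(\<Prod>k\<in>I. g k (noise k \<omega>)) = (\<alpha> i \<omega>) ^ m * (\<epsilon> i s \<omega> * \<epsilon> i t \<omega>)" for \<omega>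
    by (cases "s = t") (simp_all add: I_def g_def p_def power2_eq_square)
  show "integrable P (\<lambda>\<omega>. (\<alpha> i \<omega>) ^ m * (\<epsilon> i s \<omega> * \<epsilon> i t \<omega>))"
    using noise_product(1)[OF I meas int] unfolding prod .
  show "expectation (\<lambda>\<omega>. (\<alpha> i \<omega>) ^ m * (\<epsilon> i s \<omega> * \<epsilon> i t \<omega>)) =
           (if s = t then \<sigma>\<^sup>2 * coeff_moment a b m else 0)"
    using noise_product(2)[OF I meas int] unfolding prod
    by (cases "s = t")
      (simp_all add: I_def g_def p_def innovation_mean innovation_variance coeff_power_expectation)
qed

definition solution :: "nat \<Rightarrow> int \<Rightarrow> 'a \<Rightarrow> real" where
  "solution i t \<omega> = (\<Sum>j. (\<alpha> i \<omega>) ^ j * \<epsilon> i (t - int j) \<omega>)"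

definition partial_solution :: "nat \<Rightarrow> int \<Rightarrow> nat \<Rightarrow> 'a \<Rightarrow> real" where
  "partial_solution i t n \<omega> = (\<Sum>j<n. (\<alpha> i \<omega>) ^ j * \<epsilon> i (t - int j) \<omega>)"

lemma measurable_solution [measurable]: "solution i t \<in> borel_measurable P"
  unfolding solution_def[abs_def] by measurable

lemma measurable_partial_solution [measurable]: "partial_solution i t n \<in> borel_measurable P"
  unfolding partial_solution_def[abs_def] by measurable

text \<open>
  The expectation of \<open>\<Sum>j. \<bar>\<alpha>\<bar>\<^sup>j \<bar>\<epsilon>\<^sub>t\<^sub>-\<^sub>j\<bar>\<close> is \<open>E\<bar>\<epsilon>\<bar>\<close> times \<open>\<Sum>j. E(\<alpha>\<^sup>j)\<close>. For \<open>b > 1\<close> it is finite, so the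
  series converges absolutely almost surely.
\<close>

lemma partial_solution_tendsto_solution: "AE \<omega> in P. (\<lambda>n. partial_solution i t n \<omega>) \<longlonglongrightarrow> solution i t \<omega>"
proof -
  let ?f = "\<lambda>j \<omega>. \<bar>\<alpha> i \<omega>\<bar> ^ j * \<bar>\<epsilon> i (t - int j) \<omega>\<bar>"
  have "(\<integral>\<^sup>+\<omega>. (\<Sum>j. ennreal (?f j \<omega>)) \<partial>P) = (\<Sum>j. \<integral>\<^sup>+\<omega>. ennreal (?f j \<omega>) \<partial>P)"
    by (intro nn_integral_suminf) measurable
  also have "\<dots> = (\<Sum>j. ennreal (coeff_moment a b j * expectation (\<lambda>\<omega>. \<bar>\<epsilon> 0 0 \<omega>\<bar>)))"
    by (intro suminf_cong)
      (simp add: nn_integral_eq_integral coeff_innovation_abs_integrable coeff_innovation_abs_expectation)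
  also have "\<dots> < \<infinity>"
  proof -
    have "summable (\<lambda>j. coeff_moment a b j * expectation (\<lambda>\<omega>. \<bar>\<epsilon> 0 0 \<omega>\<bar>))"
      using summable_coeff_moment[OF a_pos b_gt_1] by (rule summable_mult2)
    moreover have "coeff_moment a b j * expectation (\<lambda>\<omega>. \<bar>\<epsilon> 0 0 \<omega>\<bar>) \<ge> 0" for j
      using coeff_moment_nonneg[of a b j] a_pos b_gt_1 by simp
    ultimately show ?thesis
      by (simp add: suminf_ennreal2)
  qed
  finally have "AE \<omega> in P. (\<Sum>j. ennreal (?f j \<omega>)) \<noteq> \<infinity>"
    by (intro nn_integral_noteq_infinite) (auto simp: less_top[symmetric])
  then show ?thesis
  proof eventually_elim
    case (elim \<omega>)
    have "summable (\<lambda>j. ?f j \<omega>)"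
      by (rule summable_suminf_not_top) (use elim in auto)
    then have "summable (\<lambda>j. (\<alpha> i \<omega>) ^ j * \<epsilon> i (t - int j) \<omega>)"
      by (intro summable_rabs_cancel[of "\<lambda>j. (\<alpha> i \<omega>) ^ j * \<epsilon> i (t - int j) \<omega>"]) (simp add: abs_mult power_abs)
    then show ?case
      unfolding partial_solution_def solution_def by (rule summable_LIMSEQ)
  qed
qed

lemma stationary_distr: "distr P borel (y i t) = distr P borel (y i s)"
proof -
  let ?N = "PiM UNIV (\<lambda>_::int. borel :: real measure)"
  have st: "distr P ?N (\<lambda>\<omega> r. y i (r + h) \<omega>) = distr P ?N (\<lambda>\<omega> r. y i r \<omega>)" for h
    using ar1_panel by (simp add: ar1_panel_def strictly_stationary_def)
  have m: "(\<lambda>\<omega> r. y i (r + h) \<omega>) \<in> measurable P ?N" for h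
    by (rule measurable_PiM_single') auto
  have "distr P borel (y i h) = distr (distr P ?N (\<lambda>\<omega> r. y i (r + h) \<omega>)) borel (\<lambda>w. w 0)" for h
    by (subst distr_distr[OF _ m]) (simp_all add: o_def)
  then have "distr P borel (y i h) = distr (distr P ?N (\<lambda>\<omega> r. y i r \<omega>)) borel (\<lambda>w. w 0)" for h
    by (simp add: st)
  then show ?thesis by metis
qed

lemma y_eq_partial_solution: "AE \<omega> in P. \<forall>n. y i t \<omega> = partial_solution i t n \<omega> + (\<alpha> i \<omega>) ^ n * y i (t - int n) \<omega>"
proof -
  have "AE \<omega> in P. \<forall>t. y i t \<omega> = \<alpha> i \<omega> * y i (t - 1) \<omega> + \<epsilon> i t \<omega>"
    by (subst AE_all_countable) (intro allI recursion)
  then show ?thesis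
  proof (eventually_elim, intro allI)
    fix \<omega> n
    assume *: "\<forall>t. y i t \<omega> = \<alpha> i \<omega> * y i (t - 1) \<omega> + \<epsilon> i t \<omega>"
    show "y i t \<omega> = partial_solution i t n \<omega> + (\<alpha> i \<omega>) ^ n * y i (t - int n) \<omega>"
    proof (induction n)
      case (Suc n)
      show ?case
        unfolding Suc using *[rule_format, of "t - int n"]
        by (simp add: partial_solution_def algebra_simps)
    qed (simp add: partial_solution_def)
  qed
qed

text \<open>
  The remainder \<open>\<alpha>\<^sup>n y\<^sub>t\<^sub>-\<^sub>n\<close> of the iterated recursion converges almost surely. Since the law of
  \<open>y\<^sub>t\<^sub>-\<^sub>n\<close> does not depend on \<open>n\<close>, it also converges to zero in probability.
\<close>
lemma y_eq_solution: "AE \<omega> in P. y i t \<omega> = solution i t \<omega>"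
proof -
  let ?D = "\<lambda>\<omega>. min 1 \<bar>y i t \<omega> - solution i t \<omega>\<bar>"
  let ?R = "\<lambda>n \<omega>. min 1 \<bar>(\<alpha> i \<omega>) ^ n * y i (t - int n) \<omega>\<bar>"
  have int1: "integrable P (\<lambda>_. 1 :: real)" by simp
  have lim: "(\<lambda>n. expectation (?R n)) \<longlonglongrightarrow> expectation ?D"
  proof (rule integral_dominated_convergence[OF _ _ int1])
    show "AE \<omega> in P. (\<lambda>n. ?R n \<omega>) \<longlonglongrightarrow> ?D \<omega>"
      using y_eq_partial_solution[of i t] partial_solution_tendsto_solution[of i t]
    proof eventually_elim
      case (elim \<omega>)
      have "(\<lambda>n. min 1 \<bar>y i t \<omega> - partial_solution i t n \<omega>\<bar>) \<longlonglongrightarrow> ?D \<omega>"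
        using elim(2) by (intro tendsto_intros)
      moreover have "y i t \<omega> - partial_solution i t n \<omega> = (\<alpha> i \<omega>) ^ n * y i (t - int n) \<omega>" for n
        using elim(1) by (metis add_diff_cancel_left')
      ultimately show ?case by simp
    qed
  qed auto
  \<comment> \<open>On \<open>\<bar>y\<^sub>t\<^sub>-\<^sub>n\<bar> \<le> K\<close> the remainder is at most \<open>\<alpha>\<^sup>n K\<close>, which tends to \<open>0\<close>; the exceptional event has
    a probability that does not depend on \<open>n\<close>.\<close>
  have bound: "expectation ?D \<le> prob {\<omega> \<in> space P. \<bar>y i t \<omega>\<bar> > real K}" for K :: nat
  proof -
    let ?G = "\<lambda>n \<omega>. min 1 (\<bar>\<alpha> i \<omega>\<bar> ^ n * real K)"
    have "(\<lambda>n. expectation (?G n)) \<longlonglongrightarrow> expectation (\<lambda>_. 0)"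
    proof (rule integral_dominated_convergence[OF _ _ int1])
      show "AE \<omega> in P. (\<lambda>n. ?G n \<omega>) \<longlonglongrightarrow> 0"
        using coeff_bounds[of i]
      proof eventually_elim
        case (elim \<omega>)
        have "(\<lambda>n. \<bar>\<alpha> i \<omega>\<bar> ^ n * real K) \<longlonglongrightarrow> 0"
          using elim by (intro tendsto_mult_left_zero LIMSEQ_realpow_zero) auto
        then have "(\<lambda>n. ?G n \<omega>) \<longlonglongrightarrow> min 1 0"
          by (intro tendsto_min tendsto_const)
        then show ?case by simp
      qed
    qed auto
    then have "(\<lambda>n. expectation (?G n) + prob {\<omega> \<in> space P. \<bar>y i t \<omega>\<bar> > real K})
        \<longlonglongrightarrow> 0 + prob {\<omega> \<in> space P. \<bar>y i t \<omega>\<bar> > real K}"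
      by (intro tendsto_add tendsto_const) simp
    moreover have "expectation (?R n) \<le> expectation (?G n) + prob {\<omega> \<in> space P. \<bar>y i t \<omega>\<bar> > real K}" for n
    proof -
      let ?A = "{\<omega> \<in> space P. \<bar>y i (t - int n) \<omega>\<bar> > real K}"
      have "expectation (?R n) \<le> expectation (\<lambda>\<omega>. ?G n \<omega> + indicator ?A \<omega>)"
      proof (rule integral_mono_AE)
        show "integrable P (?R n)"
          by (rule integrable_const_bound[where B = 1]) auto
        show "integrable P (\<lambda>\<omega>. ?G n \<omega> + indicator ?A \<omega>)"
          by (rule integrable_const_bound[where B = 2]) (auto simp: indicator_def)
        show "AE \<omega> in P. ?R n \<omega> \<le> ?G n \<omega> + indicator ?A \<omega>"
        proof (rule AE_I2)
          fix \<omega> assume "\<omega> \<in> space P"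
          show "?R n \<omega> \<le> ?G n \<omega> + indicator ?A \<omega>"
          proof (cases "\<omega> \<in> ?A")
            case True
            then have "indicator ?A \<omega> = (1 :: real)" by simp
            moreover have "?G n \<omega> \<ge> 0" "?R n \<omega> \<le> 1" by simp_all
            ultimately show ?thesis by linarith
          next
            case False
            then have "\<bar>y i (t - int n) \<omega>\<bar> \<le> real K"
              using \<open>\<omega> \<in> space P\<close> by simp
            then have "\<bar>\<alpha> i \<omega>\<bar> ^ n * \<bar>y i (t - int n) \<omega>\<bar> \<le> \<bar>\<alpha> i \<omega>\<bar> ^ n * real K"
              by (rule mult_left_mono) simp
            then have "?R n \<omega> \<le> ?G n \<omega>"
              unfolding abs_mult power_abs by (rule min.mono[OF order_refl])
            then show ?thesis using False by simp
          qed
        qed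
      qed
      also have "\<dots> = expectation (?G n) + prob ?A"
      proof (subst Bochner_Integration.integral_add)
        show "integrable P (?G n)"
          by (rule integrable_const_bound[where B = 1]) auto
        show "integrable P (indicator ?A :: 'a \<Rightarrow> real)"
          by (rule integrable_const_bound[where B = 1]) (auto simp: indicator_def)
      qed simp
      also have "prob ?A = prob {\<omega> \<in> space P. \<bar>y i t \<omega>\<bar> > real K}"
      proof -
        have "prob {\<omega> \<in> space P. \<bar>y i s \<omega>\<bar> > real K} = measure (distr P borel (y i s)) {x. \<bar>x\<bar> > real K}" for s
          by (subst measure_distr) (auto intro!: arg_cong[where f = prob])
        then show ?thesis
          using stationary_distr[of i "t - int n" t] by simp
      qed
      finally show ?thesis .
    qed
    ultimately show ?thesis
      using lim by (intro LIMSEQ_le[OF lim]) auto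
  qed
  have "(\<lambda>K::nat. expectation (indicator {\<omega> \<in> space P. \<bar>y i t \<omega>\<bar> > real K} :: 'a \<Rightarrow> real)) \<longlonglongrightarrow> expectation (\<lambda>_. 0)"
  proof (rule integral_dominated_convergence[OF _ _ int1])
    show "AE \<omega> in P. (\<lambda>K. indicator {\<omega> \<in> space P. \<bar>y i t \<omega>\<bar> > real K} \<omega> :: real) \<longlonglongrightarrow> 0"
    proof (rule AE_I2, rule tendsto_eventually)
      fix \<omega>
      obtain N :: nat where "\<bar>y i t \<omega>\<bar> \<le> real N"
        using real_arch_simple by blast
      then show "\<forall>\<^sub>F K in sequentially. indicator {\<omega> \<in> space P. \<bar>y i t \<omega>\<bar> > real K} \<omega> = (0::real)"
        by (intro eventually_sequentiallyI[of N]) (auto simp: indicator_def)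
    qed
  qed (auto simp: indicator_def)
  then have "expectation ?D \<le> 0"
    using bound by (intro LIMSEQ_le_const) auto
  moreover have "expectation ?D \<ge> 0"
    by (intro integral_nonneg_AE) auto
  moreover have "integrable P ?D"
    by (rule integrable_const_bound[where B = 1]) auto
  ultimately have "AE \<omega> in P. ?D \<omega> = 0"
    by (subst integral_nonneg_eq_0_iff_AE[symmetric]) auto
  then show ?thesis
    by eventually_elim (auto simp: min_def split: if_splits)
qed

end

context panel
begin

lemma term_square_integrable: "integrable P (\<lambda>\<omega>. ((\<alpha> i \<omega>) ^ j * \<epsilon> i t \<omega>)\<^sup>2)"
proof -
  have "((\<alpha> i \<omega>) ^ j * \<epsilon> i t \<omega>)\<^sup>2 = (\<alpha> i \<omega>) ^ (j + j) * (\<epsilon> i t \<omega> * \<epsilon> i t \<omega>)" for \<omega>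
    by (simp add: power2_eq_square power_add mult_ac)
  then show ?thesis
    using coeff_innovation_product_integrable[of i "j + j" t t] by simp
qed

text \<open>
  Distinct innovations are uncorrelated given the coefficient, so only pairs of terms that carry
  the same innovation contribute.
\<close>

lemma expectation_sum_terms:
  assumes "finite I" "finite J"
  shows "expectation (\<lambda>\<omega>. (\<Sum>j\<in>I. (\<alpha> i \<omega>) ^ j * \<epsilon> i (s - int j) \<omega>) * (\<Sum>k\<in>J. (\<alpha> i \<omega>) ^ k * \<epsilon> i (t - int k) \<omega>))
    = (\<Sum>j\<in>I. \<Sum>k\<in>J. if s - int j = t - int k then \<sigma>\<^sup>2 * coeff_moment a b (j + k) else 0)"
proof -
  have eq: "(\<Sum>j\<in>I. (\<alpha> i \<omega>) ^ j * \<epsilon> i (s - int j) \<omega>) * (\<Sum>k\<in>J. (\<alpha> i \<omega>) ^ k * \<epsilon> i (t - int k) \<omega>)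
    = (\<Sum>j\<in>I. \<Sum>k\<in>J. (\<alpha> i \<omega>) ^ (j + k) * (\<epsilon> i (s - int j) \<omega> * \<epsilon> i (t - int k) \<omega>))" for \<omega>
    unfolding sum_product by (simp add: power_add mult_ac)
  show ?thesis
    unfolding eq
    by (simp only: Bochner_Integration.integral_sum Bochner_Integration.integrable_sum
        coeff_innovation_product_integrable coeff_innovation_product_expectation)
qed

lemma partial_solution_square_integrable: "integrable P (\<lambda>\<omega>. (partial_solution i t n \<omega>)\<^sup>2)"
  unfolding partial_solution_def by (intro square_integrable_sum term_square_integrable) auto

lemma partial_solution_expectation: "expectation (partial_solution i t n) = 0"
  unfolding partial_solution_def[abs_def]
  by (simp add: Bochner_Integration.integral_sum coeff_innovation_integrable coeff_innovation_expectation)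

lemma partial_solution_diff_second_moment:
  assumes "n \<le> m"
  shows "expectation (\<lambda>\<omega>. (partial_solution i t m \<omega> - partial_solution i t n \<omega>)\<^sup>2) = (\<Sum>j=n..<m. \<sigma>\<^sup>2 * coeff_moment a b (2 * j))"
proof -
  have "partial_solution i t m \<omega> - partial_solution i t n \<omega> = (\<Sum>j=n..<m. (\<alpha> i \<omega>) ^ j * \<epsilon> i (t - int j) \<omega>)" for \<omega>
    using sum_diff_nat_ivl[of 0 n m "\<lambda>j. (\<alpha> i \<omega>) ^ j * \<epsilon> i (t - int j) \<omega>"] assms
    by (simp add: partial_solution_def lessThan_atLeast0)
  then have "expectation (\<lambda>\<omega>. (partial_solution i t m \<omega> - partial_solution i t n \<omega>)\<^sup>2) =
      (\<Sum>j=n..<m. \<Sum>k=n..<m. if t - int j = t - int k then \<sigma>\<^sup>2 * coeff_moment a b (j + k) else 0)"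
    by (simp only: power2_eq_square[of "sum _ _"]) (intro expectation_sum_terms finite_atLeastLessThan)
  also have "\<dots> = (\<Sum>j=n..<m. \<sigma>\<^sup>2 * coeff_moment a b (2 * j))"
    by (rule sum.cong) (simp_all add: mult_2)
  finally show ?thesis .
qed

text \<open>
  Fatou's lemma transfers the bound on the differences of partial sums to their almost sure limit.
  Integrability of the left-hand side is not yet known, hence the nonnegative integral.
\<close>

lemma solution_partial_solution_nn_integral_le:
  "(\<integral>\<^sup>+\<omega>. ennreal ((solution i t \<omega> - partial_solution i t n \<omega>)\<^sup>2) \<partial>P) \<le> ennreal (\<Sum>j. \<sigma>\<^sup>2 * coeff_moment a b (2 * (j + n)))"
proof -
  have sm: "summable (\<lambda>j. \<sigma>\<^sup>2 * coeff_moment a b (2 * j))"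
    using coeff_moment_sums[OF a_pos b_gt_1, of \<sigma> 0] by (simp add: sums_iff)
  have nn: "\<sigma>\<^sup>2 * coeff_moment a b (2 * j) \<ge> 0" for j
    using a_pos b_gt_1 by (simp add: coeff_moment_nonneg)
  have "(\<integral>\<^sup>+\<omega>. ennreal ((solution i t \<omega> - partial_solution i t n \<omega>)\<^sup>2) \<partial>P)
      \<le> (\<integral>\<^sup>+\<omega>. liminf (\<lambda>m. ennreal ((partial_solution i t m \<omega> - partial_solution i t n \<omega>)\<^sup>2)) \<partial>P)"
  proof (rule nn_integral_mono_AE)
    show "AE \<omega> in P. ennreal ((solution i t \<omega> - partial_solution i t n \<omega>)\<^sup>2) \<le> liminf (\<lambda>m. ennreal ((partial_solution i t m \<omega> - partial_solution i t n \<omega>)\<^sup>2))"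
      using partial_solution_tendsto_solution[of i t]
    proof eventually_elim
      case (elim \<omega>)
      have "(\<lambda>m. ennreal ((partial_solution i t m \<omega> - partial_solution i t n \<omega>)\<^sup>2)) \<longlonglongrightarrow> ennreal ((solution i t \<omega> - partial_solution i t n \<omega>)\<^sup>2)"
        by (intro tendsto_ennrealI tendsto_intros elim)
      from lim_imp_Liminf[OF sequentially_bot this] show ?case
        by simp
    qed
  qed
  also have "\<dots> \<le> liminf (\<lambda>m. \<integral>\<^sup>+\<omega>. ennreal ((partial_solution i t m \<omega> - partial_solution i t n \<omega>)\<^sup>2) \<partial>P)"
    by (rule nn_integral_liminf) measurable
  also have "\<dots> \<le> ennreal (\<Sum>j. \<sigma>\<^sup>2 * coeff_moment a b (2 * (j + n)))"
  proof (rule Liminf_le)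
    show "\<forall>\<^sub>F m in sequentially. (\<integral>\<^sup>+\<omega>. ennreal ((partial_solution i t m \<omega> - partial_solution i t n \<omega>)\<^sup>2) \<partial>P)
        \<le> ennreal (\<Sum>j. \<sigma>\<^sup>2 * coeff_moment a b (2 * (j + n)))"
      using eventually_ge_at_top[of n]
    proof eventually_elim
      case (elim m)
      have "(\<integral>\<^sup>+\<omega>. ennreal ((partial_solution i t m \<omega> - partial_solution i t n \<omega>)\<^sup>2) \<partial>P) = ennreal (expectation (\<lambda>\<omega>. (partial_solution i t m \<omega> - partial_solution i t n \<omega>)\<^sup>2))"
        by (intro nn_integral_eq_integral square_integrable_diff partial_solution_square_integrable) auto
      also have "expectation (\<lambda>\<omega>. (partial_solution i t m \<omega> - partial_solution i t n \<omega>)\<^sup>2) = (\<Sum>j=n..<m. \<sigma>\<^sup>2 * coeff_moment a b (2 * j))"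
        by (rule partial_solution_diff_second_moment[OF elim])
      also have "\<dots> = (\<Sum>j<m - n. \<sigma>\<^sup>2 * coeff_moment a b (2 * (j + n)))"
        by (rule sum.reindex_bij_witness[of _ "\<lambda>j. j + n" "\<lambda>j. j - n"]) auto
      also have "\<dots> \<le> (\<Sum>j. \<sigma>\<^sup>2 * coeff_moment a b (2 * (j + n)))"
        using summable_ignore_initial_segment[OF sm, of n] by (intro sum_le_suminf nn) auto
      finally show ?case by (simp add: ennreal_leI)
    qed
  qed simp
  finally show ?thesis .
qed

lemma partial_solution_mean_square_limit: "mean_square_limit P (partial_solution i t) (solution i t)"
proof -
  define tail where "tail n = (\<Sum>j. \<sigma>\<^sup>2 * coeff_moment a b (2 * (j + n)))" for n
  have sm: "summable (\<lambda>j. \<sigma>\<^sup>2 * coeff_moment a b (2 * j))"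
    using coeff_moment_sums[OF a_pos b_gt_1, of \<sigma> 0] by (simp add: sums_iff)
  have tail0: "tail n \<ge> 0" for n
    unfolding tail_def using a_pos b_gt_1 summable_ignore_initial_segment[OF sm, of n]
    by (intro suminf_nonneg) (auto simp: coeff_moment_nonneg)
  have le: "(\<integral>\<^sup>+\<omega>. ennreal ((solution i t \<omega> - partial_solution i t n \<omega>)\<^sup>2) \<partial>P) \<le> ennreal (tail n)" for n
    unfolding tail_def by (rule solution_partial_solution_nn_integral_le)
  have int: "integrable P (\<lambda>\<omega>. (solution i t \<omega> - partial_solution i t n \<omega>)\<^sup>2)" for n
  proof (rule integrableI_nonneg)
    show "(\<integral>\<^sup>+\<omega>. ennreal ((solution i t \<omega> - partial_solution i t n \<omega>)\<^sup>2) \<partial>P) < \<infinity>"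
      using le[of n] by (rule le_less_trans) simp
  qed auto
  have u2: "integrable P (\<lambda>\<omega>. (solution i t \<omega>)\<^sup>2)"
    using int[of 0] by (simp add: partial_solution_def)
  have bound: "expectation (\<lambda>\<omega>. (partial_solution i t n \<omega> - solution i t \<omega>)\<^sup>2) \<le> tail n" for n
  proof -
    have "ennreal (expectation (\<lambda>\<omega>. (solution i t \<omega> - partial_solution i t n \<omega>)\<^sup>2)) \<le> ennreal (tail n)"
      using le[of n] nn_integral_eq_integral[OF int[of n]] by simp
    then have "expectation (\<lambda>\<omega>. (solution i t \<omega> - partial_solution i t n \<omega>)\<^sup>2) \<le> tail n"
      using tail0[of n] by simp
    then show ?thesis by (simp add: power2_commute)
  qed
  have "tail \<longlonglongrightarrow> 0"
    unfolding tail_def using suminf_exist_split2[OF sm] by simp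
  then have "(\<lambda>n. expectation (\<lambda>\<omega>. (partial_solution i t n \<omega> - solution i t \<omega>)\<^sup>2)) \<longlonglongrightarrow> 0"
    by (rule tendsto_sandwich[OF _ _ tendsto_const, rotated 2]) (use bound in auto)
  then show ?thesis
    unfolding mean_square_limit_def using partial_solution_square_integrable u2 by auto
qed

lemma solution_square_integrable: "integrable P (\<lambda>\<omega>. (solution i t \<omega>)\<^sup>2)"
  using partial_solution_mean_square_limit[of i t] by (simp add: mean_square_limit_def)

lemma solution_expectation: "expectation (solution i t) = 0"
  using mean_square_limit_expectation[OF partial_solution_mean_square_limit[of i t]]
  by (simp add: partial_solution_expectation LIMSEQ_const_iff)

lemma solution_autocovariance_nat:
  "expectation (\<lambda>\<omega>. solution i s \<omega> * solution i (s + int h) \<omega>) = csa_autocov a b \<sigma> (int h)"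
proof -
  have "expectation (\<lambda>\<omega>. partial_solution i s n \<omega> * partial_solution i (s + int h) n \<omega>) = (\<Sum>j<n - h. \<sigma>\<^sup>2 * coeff_moment a b (2 * j + h))" for n
  proof -
    have "expectation (\<lambda>\<omega>. partial_solution i s n \<omega> * partial_solution i (s + int h) n \<omega>) =
        (\<Sum>j<n. \<Sum>k<n. if s - int j = s + int h - int k then \<sigma>\<^sup>2 * coeff_moment a b (j + k) else 0)"
      unfolding partial_solution_def by (rule expectation_sum_terms) auto
    also have "\<dots> = (\<Sum>j<n. \<Sum>k<n. if k = j + h then \<sigma>\<^sup>2 * coeff_moment a b (j + k) else 0)"
      by (intro sum.cong refl if_cong) auto
    also have "\<dots> = (\<Sum>j<n. if j + h < n then \<sigma>\<^sup>2 * coeff_moment a b (2 * j + h) else 0)"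
      by (intro sum.cong refl) (simp add: sum.delta' mult_2 add.assoc)
    also have "\<dots> = (\<Sum>j<n - h. \<sigma>\<^sup>2 * coeff_moment a b (2 * j + h))"
      by (rule sum.mono_neutral_cong_right) auto
    finally show ?thesis .
  qed
  moreover have "(\<lambda>n. \<Sum>j<n - h. \<sigma>\<^sup>2 * coeff_moment a b (2 * j + h)) \<longlonglongrightarrow> csa_autocov a b \<sigma> (int h)"
    using coeff_moment_sums[OF a_pos b_gt_1, of \<sigma> h] unfolding sums_def
    by (rule filterlim_compose) (rule filterlim_minus_const_nat_at_top)
  ultimately show ?thesis
    using LIMSEQ_unique[OF mean_square_limit_mult[OF partial_solution_mean_square_limit[of i s] partial_solution_mean_square_limit[of i "s + int h"]]]
    by simp
qed

lemma solution_autocovariance: "expectation (\<lambda>\<omega>. solution i s \<omega> * solution i t \<omega>) = csa_autocov a b \<sigma> (t - s)"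
proof (cases "s \<le> t")
  case True
  then show ?thesis
    using solution_autocovariance_nat[of i s "nat (t - s)"] by simp
next
  case False
  then have "expectation (\<lambda>\<omega>. solution i t \<omega> * solution i s \<omega>) = csa_autocov a b \<sigma> (s - t)"
    using solution_autocovariance_nat[of i t "nat (s - t)"] by simp
  then show ?thesis
    using csa_autocov_minus[of a b \<sigma> "s - t"] by (simp add: mult.commute)
qed

section \<open>The central limit theorem for the panel\<close>

definition series_sum :: "int set \<Rightarrow> nat \<Rightarrow> 'a \<Rightarrow> real" where
  "series_sum T i \<omega> = (\<Sum>t\<in>T. solution i t \<omega>)"

definition lim_var :: "int set \<Rightarrow> real" where
  "lim_var T = (\<Sum>s\<in>T. \<Sum>t\<in>T. csa_autocov a b \<sigma> (t - s))"

lemma lim_var_pos: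
  assumes "finite T" "T \<noteq> {}"
  shows "lim_var T > 0"
  unfolding lim_var_def using assms csa_autocov_pos[OF a_pos b_gt_1 sigma_pos]
  by (intro sum_pos) auto

lemma series_sum_square_integrable: "finite T \<Longrightarrow> integrable P (\<lambda>\<omega>. (series_sum T i \<omega>)\<^sup>2)"
  unfolding series_sum_def by (intro square_integrable_sum solution_square_integrable) auto

lemma series_sum_expectation: "finite T \<Longrightarrow> expectation (series_sum T i) = 0"
  unfolding series_sum_def[abs_def]
  by (subst Bochner_Integration.integral_sum)
    (auto simp: solution_expectation intro!: square_integrable_imp_integrable[OF _ solution_square_integrable])

lemma series_sum_second_moment:
  assumes "finite T"
  shows "expectation (\<lambda>\<omega>. (series_sum T i \<omega>)\<^sup>2) = lim_var T"
proof -
  have i: "integrable P (\<lambda>\<omega>. solution i s \<omega> * solution i t \<omega>)" for s t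
    by (intro square_integrable_mult solution_square_integrable) auto
  show ?thesis
    unfolding series_sum_def lim_var_def power2_eq_square sum_product
    by (simp only: Bochner_Integration.integral_sum Bochner_Integration.integrable_sum i solution_autocovariance)
qed

text \<open>
  The inputs of the \<open>i\<close>-th series are indexed by \<open>int option\<close>: \<open>None\<close> stands for the coefficient and
  \<open>Some t\<close> for the innovation at time \<open>t\<close>. With this common index type, the sums over \<open>T\<close> are one and the
  same function of the inputs for all \<open>i\<close>, which yields both independence and equality in law.
\<close>

definition series_sum_of_inputs :: "int set \<Rightarrow> (int option \<Rightarrow> real) \<Rightarrow> real" where
  "series_sum_of_inputs T w = (\<Sum>t\<in>T. \<Sum>j. (w None) ^ j * w (Some (t - int j)))"

definition inputs :: "nat \<Rightarrow> int option \<Rightarrow> nat + nat \<times> int" where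
  "inputs i k = (case k of None \<Rightarrow> Inl i | Some t \<Rightarrow> Inr (i, t))"

lemma series_sum_eq_inputs: "series_sum T i \<omega> = series_sum_of_inputs T (\<lambda>k. noise (inputs i k) \<omega>)"
  by (simp add: series_sum_def solution_def series_sum_of_inputs_def inputs_def)

lemma measurable_series_sum_of_inputs: "series_sum_of_inputs T \<in> borel_measurable (PiM UNIV (\<lambda>_. borel))"
  unfolding series_sum_of_inputs_def[abs_def] by measurable

lemma inj_inputs: "inj (inputs i)"
  by (auto simp: inj_def inputs_def split: option.splits)

lemma indep_series_sum: "indep_vars (\<lambda>_. borel) (series_sum T) UNIV"
proof -
  have "indep_vars (\<lambda>i. PiM (range (inputs i)) (\<lambda>_. borel)) (\<lambda>i \<omega>. restrict (\<lambda>k. noise k \<omega>) (range (inputs i))) UNIV"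
    by (rule indep_vars_restrict[OF indep_noise])
      (auto simp: disjoint_family_on_def inputs_def split: option.splits)
  then have "indep_vars (\<lambda>_. borel) (\<lambda>i \<omega>. (\<lambda>v. series_sum_of_inputs T (\<lambda>k. v (inputs i k))) (restrict (\<lambda>k. noise k \<omega>) (range (inputs i)))) UNIV"
  proof (rule indep_vars_compose2)
    fix i
    have "(\<lambda>v k. v (inputs i k)) \<in> measurable (PiM (range (inputs i)) (\<lambda>_. borel)) (PiM UNIV (\<lambda>_. borel :: real measure))"
      by (rule measurable_PiM_single') (auto intro!: measurable_component_singleton)
    then show "(\<lambda>v. series_sum_of_inputs T (\<lambda>k. v (inputs i k))) \<in> borel_measurable (PiM (range (inputs i)) (\<lambda>_. borel))"
      by (rule measurable_compose[OF _ measurable_series_sum_of_inputs])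
  qed
  then show ?thesis
    by (simp add: series_sum_eq_inputs[abs_def])
qed

text \<open>
  The law of \<open>\<alpha>\<^sup>2\<close> determines the law of \<open>\<alpha>\<close> since \<open>\<alpha>\<close> is positive.
\<close>

lemma coeff_distr: "distr P borel (\<alpha> i) = distr P borel (\<alpha> 0)"
proof -
  have "distr P borel (\<alpha> i) = distr (distr P lborel (\<lambda>\<omega>. (\<alpha> i \<omega>)\<^sup>2)) borel sqrt" for i
  proof -
    have "distr (distr P lborel (\<lambda>\<omega>. (\<alpha> i \<omega>)\<^sup>2)) borel sqrt = distr P borel (\<lambda>\<omega>. sqrt ((\<alpha> i \<omega>)\<^sup>2))"
      by (subst distr_distr) (auto simp: o_def)
    also have "\<dots> = distr P borel (\<alpha> i)"
      using coeff_bounds[of i] by (intro distr_cong_AE) (auto elim!: eventually_mono)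
    finally show ?thesis by simp
  qed
  then show ?thesis
    using distributed_distr_eq_density[OF coeff_square_distributed] by metis
qed

lemma series_sum_distr: "distr P borel (series_sum T i) = distr P borel (series_sum T 0)"
proof -
  let ?N = "PiM UNIV (\<lambda>_::int option. borel :: real measure)"
  have "distr P borel (series_sum T i) = distr (PiM UNIV (\<lambda>k. distr P borel (noise (inputs i k)))) borel (series_sum_of_inputs T)" for i
  proof -
    let ?L = "PiM UNIV (\<lambda>_::nat + nat \<times> int. borel :: real measure)"
    let ?D = "PiM UNIV (\<lambda>k. distr P borel (noise k))"
    let ?DI = "PiM UNIV (\<lambda>k. distr P borel (noise (inputs i k)))"
    have D: "distr P ?L (\<lambda>\<omega> k. noise k \<omega>) = ?D"
      using indep_vars_iff_distr_eq_PiM[where I = UNIV and M' = "\<lambda>_. borel" and X = noise] indep_noise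
      by (simp add: restrict_UNIV)
    have re: "(\<lambda>w k. w (inputs i k)) \<in> measurable ?L ?N"
      by (rule measurable_PiM_single') (auto intro!: measurable_component_singleton)
    have nm: "(\<lambda>\<omega> k. noise k \<omega>) \<in> measurable P ?L"
      by (rule measurable_PiM_single') auto
    have sets: "sets ?DI = sets ?N"
      by (intro sets_PiM_cong) auto
    have "distr ?D ?DI (\<lambda>w. \<lambda>k\<in>UNIV. w (inputs i k)) = ?DI"
      by (rule distr_PiM_reindex) (use inj_inputs in \<open>auto intro!: prob_space_distr\<close>)
    then have "?DI = distr ?D ?N (\<lambda>w k. w (inputs i k))"
      using distr_cong[OF refl sets, of ?D "\<lambda>w k. w (inputs i k)" "\<lambda>w k. w (inputs i k)"]
      by (simp add: restrict_UNIV)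
    also have "\<dots> = distr P ?N (\<lambda>\<omega> k. noise (inputs i k) \<omega>)"
      unfolding D[symmetric] by (subst distr_distr[OF re nm]) (simp add: o_def)
    finally have "distr P ?N (\<lambda>\<omega> k. noise (inputs i k) \<omega>) = ?DI" ..
    moreover have "(\<lambda>\<omega> k. noise (inputs i k) \<omega>) \<in> measurable P ?N"
      by (rule measurable_PiM_single') auto
    ultimately show ?thesis
      using distr_distr[OF measurable_series_sum_of_inputs[of T], of "\<lambda>\<omega> k. noise (inputs i k) \<omega>" P]
      by (simp add: o_def series_sum_eq_inputs[abs_def])
  qed
  moreover have "distr P borel (noise (inputs i k)) = distr P borel (noise (inputs 0 k))" for k
    using coeff_distr[of i] innovation_distr[of i "the k"] innovation_distr[of 0 "the k"]
    by (cases k) (simp_all add: inputs_def)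
  ultimately show ?thesis by simp
qed

lemma panel_char_limit:
  assumes T: "finite T" "T \<noteq> {}"
  shows "(\<lambda>N. char (distr P borel (\<lambda>\<omega>. (\<Sum>i<N. series_sum T i \<omega>) / sqrt (real N))) \<theta>)
      \<longlonglongrightarrow> exp (- (lim_var T * \<theta>\<^sup>2) / 2)"
proof -
  define v where "v = sqrt (lim_var T)"
  have v: "v > 0" "v\<^sup>2 = lim_var T"
    using lim_var_pos[OF T] by (simp_all add: v_def)
  let ?Z = "\<lambda>N \<omega>. (\<Sum>i<N. series_sum T i \<omega>) / sqrt (real N * v\<^sup>2)"
  have [measurable]: "series_sum T i \<in> borel_measurable P" for i
    unfolding series_sum_def[abs_def] by measurable
  have "weak_conv_m (\<lambda>N. distr P borel (?Z N)) std_normal_distribution"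
  proof (rule central_limit_theorem_zero_mean[OF indep_series_sum _ v(1)])
    show "distr P borel (series_sum T i) = distr P borel (series_sum T 0)" for i
      by (rule series_sum_distr)
  qed (simp_all add: T series_sum_expectation series_sum_square_integrable series_sum_second_moment v)
  then have "(\<lambda>N. char (distr P borel (?Z N)) (v * \<theta>)) \<longlonglongrightarrow> char std_normal_distribution (v * \<theta>)"
    by (intro levy_continuity1 real_distribution_distr real_dist_normal_dist) measurable
  moreover have "char (distr P borel (?Z N)) (v * \<theta>) = char (distr P borel (\<lambda>\<omega>. (\<Sum>i<N. series_sum T i \<omega>) / sqrt (real N))) \<theta>" for N
  proof -
    have "(v * \<theta>) * ?Z N \<omega> = \<theta> * ((\<Sum>i<N. series_sum T i \<omega>) / sqrt (real N))" for \<omega>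
      using v(1) by (simp add: real_sqrt_mult)
    then show ?thesis
      by (simp only: char_def) (simp add: integral_distr flip: of_real_mult)
  qed
  ultimately show ?thesis
    by (simp add: char_std_normal_distribution power_mult_distrib v)
qed

end

section \<open>The law of the aggregate\<close>

lemma char_eq_cos_sin:
  assumes "real_distribution \<mu>"
  shows "char \<mu> \<theta> = complex_of_real (\<integral>s. cos (\<theta> * s) \<partial>\<mu>) + \<i> * complex_of_real (\<integral>s. sin (\<theta> * s) \<partial>\<mu>)"
proof -
  interpret real_distribution \<mu> by (rule assms)
  have c: "integrable \<mu> (\<lambda>s. cos (\<theta> * s))" and s: "integrable \<mu> (\<lambda>s. sin (\<theta> * s))"
    by (rule integrable_const_bound[where B = 1]; simp)+
  have "iexp (\<theta> * s) = complex_of_real (cos (\<theta> * s)) + \<i> * complex_of_real (sin (\<theta> * s))" for s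
    by (simp add: cis_conv_exp[symmetric] complex_eq_iff flip: of_real_mult)
  then have "char \<mu> \<theta> = (\<integral>s. complex_of_real (cos (\<theta> * s)) + \<i> * complex_of_real (sin (\<theta> * s)) \<partial>\<mu>)"
    by (simp add: char_def)
  also have "\<dots> = complex_of_real (\<integral>s. cos (\<theta> * s) \<partial>\<mu>) + \<i> * complex_of_real (\<integral>s. sin (\<theta> * s) \<partial>\<mu>)"
    using c s by simp
  finally show ?thesis .
qed

locale csa_process = panel P \<alpha> \<epsilon> y a b \<sigma> + M: prob_space M
  for P :: "'a measure" and \<alpha> :: "nat \<Rightarrow> 'a \<Rightarrow> real" and \<epsilon> y :: "nat \<Rightarrow> int \<Rightarrow> 'a \<Rightarrow> real"
    and a b \<sigma> :: real and M :: "'b measure" +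
  fixes x :: "int \<Rightarrow> 'b \<Rightarrow> real"
  assumes measurable_x [measurable]: "x t \<in> borel_measurable M"
    and fdd: "fdd_converges P (panel_aggregate y) M x"
begin

lemma sum_aggregate_eq: "(\<Sum>t\<in>T. panel_aggregate solution N t \<omega>) = (\<Sum>i<N. series_sum T i \<omega>) / sqrt (real N)"
  unfolding panel_aggregate_def series_sum_def sum_divide_distrib[symmetric] by (subst sum.swap) simp

text \<open>
  A bounded continuous function of \<open>\<Sum>t\<in>T. x t\<close> is an admissible test function for the convergence of
  finite-dimensional distributions.
\<close>

lemma fdd_sum:
  fixes g :: "real \<Rightarrow> real"
  assumes T: "finite T" and g: "continuous_on UNIV g" "bounded (range g)"
  shows "(\<lambda>N. \<integral>s. g s \<partial>distr P borel (\<lambda>\<omega>. (\<Sum>i<N. series_sum T i \<omega>) / sqrt (real N)))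
    \<longlonglongrightarrow> (\<integral>s. g s \<partial>distr M borel (\<lambda>\<omega>. \<Sum>t\<in>T. x t \<omega>))"
proof -
  have [measurable]: "g \<in> borel_measurable borel"
    using g(1) by (rule borel_measurable_continuous_onI)
  have [measurable]: "series_sum T i \<in> borel_measurable P" for i
    unfolding series_sum_def[abs_def] by measurable
  have [measurable]: "panel_aggregate y N t \<in> borel_measurable P" for N t
    unfolding panel_aggregate_def[abs_def] by measurable
  define f where "f w = g (\<Sum>t\<in>T. w t)" for w :: "int \<Rightarrow> real"
  have "continuous_on UNIV f"
    unfolding f_def
    by (intro continuous_on_compose2[OF g(1)] continuous_on_sum continuous_on_product_coordinates) auto
  moreover have "bounded (range f)"
    by (rule bounded_subset[OF g(2)]) (auto simp: f_def)
  ultimately have "(\<lambda>N. \<integral>\<omega>. f (\<lambda>t. if t \<in> T then panel_aggregate y N t \<omega> else 0) \<partial>P)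
      \<longlonglongrightarrow> (\<integral>\<omega>. f (\<lambda>t. if t \<in> T then x t \<omega> else 0) \<partial>M)"
    using fdd T unfolding fdd_converges_def by blast
  then have lim: "(\<lambda>N. \<integral>\<omega>. g (\<Sum>t\<in>T. panel_aggregate y N t \<omega>) \<partial>P) \<longlonglongrightarrow> (\<integral>\<omega>. g (\<Sum>t\<in>T. x t \<omega>) \<partial>M)"
    by (simp add: f_def)
  have "(\<integral>\<omega>. g (\<Sum>t\<in>T. panel_aggregate y N t \<omega>) \<partial>P) = (\<integral>\<omega>. g ((\<Sum>i<N. series_sum T i \<omega>) / sqrt (real N)) \<partial>P)" for N
  proof (rule integral_cong_AE)
    have "AE \<omega> in P. \<forall>i. \<forall>t. y i t \<omega> = solution i t \<omega>"
      by (simp only: AE_all_countable) (intro allI y_eq_solution)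
    then show "AE \<omega> in P. g (\<Sum>t\<in>T. panel_aggregate y N t \<omega>) = g ((\<Sum>i<N. series_sum T i \<omega>) / sqrt (real N))"
      by eventually_elim (simp add: panel_aggregate_def flip: sum_aggregate_eq)
  qed measurable
  then show ?thesis
    using lim by (simp add: integral_distr)
qed

text \<open>
  The characteristic function of \<open>\<Sum>t\<in>T. x t\<close> is the limit of those of the aggregates, because cosine and
  sine are bounded and continuous; by the central limit theorem this limit is Gaussian. The variance
  \<open>lim_var T\<close> is strictly positive because all the autocovariances are, so no degenerate case arises.
\<close>

lemma sum_x_normal:
  assumes T: "finite T" "T \<noteq> {}"
  shows "distr M borel (\<lambda>\<omega>. (\<Sum>t\<in>T. x t \<omega>) / sqrt (lim_var T)) = std_normal_distribution"
proof (rule Levy_uniqueness)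
  let ?X = "\<lambda>\<omega>. \<Sum>t\<in>T. x t \<omega>"
  let ?\<mu> = "\<lambda>N. distr P borel (\<lambda>\<omega>. (\<Sum>i<N. series_sum T i \<omega>) / sqrt (real N))"
  let ?\<nu> = "distr M borel ?X"
  have v: "lim_var T > 0"
    by (rule lim_var_pos[OF T])
  have [measurable]: "series_sum T i \<in> borel_measurable P" for i
    unfolding series_sum_def[abs_def] by measurable
  have rd: "real_distribution (?\<mu> N)" "real_distribution ?\<nu>" for N
    by (auto intro!: real_distribution_distr M.real_distribution_distr)
  show "real_distribution (distr M borel (\<lambda>\<omega>. ?X \<omega> / sqrt (lim_var T)))"
    by (rule M.real_distribution_distr) measurable
  show "real_distribution std_normal_distribution"
    by (rule real_dist_normal_dist)
  have char: "char ?\<nu> \<theta> = exp (- (lim_var T * \<theta>\<^sup>2) / 2)" for \<theta>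
  proof (rule LIMSEQ_unique[OF _ panel_char_limit[OF T]])
    have "bounded (range (\<lambda>s. cos (\<theta> * s)))" "bounded (range (\<lambda>s. sin (\<theta> * s)))"
      by (auto intro!: boundedI[where B = 1])
    then show "(\<lambda>N. char (?\<mu> N) \<theta>) \<longlonglongrightarrow> char ?\<nu> \<theta>"
      unfolding char_eq_cos_sin[OF rd(1)] char_eq_cos_sin[OF rd(2)]
      by (intro tendsto_add tendsto_mult tendsto_const tendsto_of_real fdd_sum T continuous_intros)
  qed
  show "char (distr M borel (\<lambda>\<omega>. ?X \<omega> / sqrt (lim_var T))) = char std_normal_distribution"
  proof
    fix \<theta>
    have "char (distr M borel (\<lambda>\<omega>. ?X \<omega> / sqrt (lim_var T))) \<theta> = char ?\<nu> (\<theta> / sqrt (lim_var T))"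
      unfolding char_def by (subst (1 2) integral_distr) (auto simp: of_real_divide)
    also have "\<dots> = char std_normal_distribution \<theta>"
      using v by (simp add: char char_std_normal_distribution power_divide)
    finally show "char (distr M borel (\<lambda>\<omega>. ?X \<omega> / sqrt (lim_var T))) \<theta> = char std_normal_distribution \<theta>" .
  qed
qed

lemma sum_x_moments:
  assumes T: "finite T" "T \<noteq> {}"
  shows "integrable M (\<lambda>\<omega>. (\<Sum>t\<in>T. x t \<omega>)\<^sup>2)"
    and "M.expectation (\<lambda>\<omega>. \<Sum>t\<in>T. x t \<omega>) = 0"
    and "M.expectation (\<lambda>\<omega>. (\<Sum>t\<in>T. x t \<omega>)\<^sup>2) = lim_var T"
proof -
  let ?Z = "\<lambda>\<omega>. (\<Sum>t\<in>T. x t \<omega>) / sqrt (lim_var T)"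
  have v: "lim_var T > 0"
    by (rule lim_var_pos[OF T])
  have Zm: "?Z \<in> borel_measurable M" by measurable
  have i: "integrable M (\<lambda>\<omega>. ?Z \<omega> ^ k)" for k
    using integrable_std_normal_distribution_moment[of k] integrable_distr_eq[OF Zm, of "\<lambda>s. s ^ k"]
    by (simp add: sum_x_normal[OF T])
  have e: "M.expectation (\<lambda>\<omega>. ?Z \<omega> ^ k) = (\<integral>s. s ^ k \<partial>std_normal_distribution)" for k
    using integral_distr[OF Zm, of "\<lambda>s. s ^ k"] by (simp add: sum_x_normal[OF T])
  have sq: "(\<Sum>t\<in>T. x t \<omega>)\<^sup>2 = lim_var T * ?Z \<omega> ^ 2" for \<omega>
    using v by (simp add: power_divide)
  show "integrable M (\<lambda>\<omega>. (\<Sum>t\<in>T. x t \<omega>)\<^sup>2)"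
    unfolding sq using i by (rule integrable_mult_right)
  have "M.expectation (\<lambda>\<omega>. (\<Sum>t\<in>T. x t \<omega>)\<^sup>2) = lim_var T * M.expectation (\<lambda>\<omega>. ?Z \<omega> ^ 2)"
    unfolding sq by (rule integral_mult_right_zero)
  then show "M.expectation (\<lambda>\<omega>. (\<Sum>t\<in>T. x t \<omega>)\<^sup>2) = lim_var T"
    using e[of 2] std_normal_distribution_even_moments(1)[of 1] by simp
  have "M.expectation ?Z = 0"
    using e[of 1] integral_std_normal_distribution_moment_odd[of 1] by simp
  then show "M.expectation (\<lambda>\<omega>. \<Sum>t\<in>T. x t \<omega>) = 0"
    using v by simp
qed

lemma x_square_integrable: "integrable M (\<lambda>\<omega>. (x t \<omega>)\<^sup>2)"
  using sum_x_moments(1)[of "{t}"] by simp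

lemma x_integrable: "integrable M (x t)"
  by (rule M.square_integrable_imp_integrable[OF _ x_square_integrable]) simp

lemma x_expectation: "M.expectation (x t) = 0"
  using sum_x_moments(2)[of "{t}"] by simp

lemma x_mult_integrable: "integrable M (\<lambda>\<omega>. x s \<omega> * x t \<omega>)"
  by (intro square_integrable_mult x_square_integrable) auto

lemma x_second_moment: "M.expectation (\<lambda>\<omega>. (x t \<omega>)\<^sup>2) = csa_autocov a b \<sigma> 0"
  using sum_x_moments(3)[of "{t}"] by (simp add: lim_var_def)

text \<open>
  By polarisation, sums over sets of one and of two time points determine all the covariances.
\<close>

lemma x_autocovariance: "M.expectation (\<lambda>\<omega>. x s \<omega> * x t \<omega>) = csa_autocov a b \<sigma> (t - s)"
proof (cases "s = t")
  case True
  then show ?thesis using x_second_moment[of t] by (simp add: power2_eq_square)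
next
  case False
  have "M.expectation (\<lambda>\<omega>. (x s \<omega> + x t \<omega>)\<^sup>2) =
      csa_autocov a b \<sigma> 0 + csa_autocov a b \<sigma> (t - s) + (csa_autocov a b \<sigma> (s - t) + csa_autocov a b \<sigma> 0)"
    using sum_x_moments(3)[of "{s, t}"] False by (simp add: lim_var_def)
  also have "csa_autocov a b \<sigma> (s - t) = csa_autocov a b \<sigma> (t - s)"
    using csa_autocov_minus[of a b \<sigma> "t - s"] by simp
  also have "M.expectation (\<lambda>\<omega>. (x s \<omega> + x t \<omega>)\<^sup>2) =
      M.expectation (\<lambda>\<omega>. (x s \<omega>)\<^sup>2 + (x t \<omega>)\<^sup>2 + 2 * (x s \<omega> * x t \<omega>))"
    by (simp add: power2_sum mult.assoc)
  also have "\<dots> = csa_autocov a b \<sigma> 0 + csa_autocov a b \<sigma> 0 + 2 * M.expectation (\<lambda>\<omega>. x s \<omega> * x t \<omega>)"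
    using x_square_integrable x_mult_integrable by (simp add: x_second_moment)
  finally show ?thesis by simp
qed

end

section \<open>The forecast errors\<close>

locale csa_filtered = csa_process P \<alpha> \<epsilon> y a b \<sigma> M x
  for P :: "'a measure" and \<alpha> :: "nat \<Rightarrow> 'a \<Rightarrow> real" and \<epsilon> y :: "nat \<Rightarrow> int \<Rightarrow> 'a \<Rightarrow> real"
    and a b \<sigma> :: real and M :: "'b measure" and x :: "int \<Rightarrow> 'b \<Rightarrow> real" +
  fixes d :: real and z :: "int \<Rightarrow> 'b \<Rightarrow> real"
  assumes b_less_3: "b < 3" and b_not_2: "b \<noteq> 2" and d_eq: "d = 1 - b / 2"
    and frac_diff: "is_frac_diff M d x z"
begin

sublocale csa_params a b d \<sigma>
  using a_pos b_gt_1 b_less_3 b_not_2 d_eq sigma_pos by unfold_locales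

lemma z_limit: "mean_square_limit M (\<lambda>n \<omega>. \<Sum>j<n. frac_diff_coeff d j * x (t - int j) \<omega>) (z t)"
  using frac_diff by (simp add: is_frac_diff_def)

lemma measurable_z [measurable]: "z t \<in> borel_measurable M"
  and z_square_integrable: "integrable M (\<lambda>\<omega>. (z t \<omega>)\<^sup>2)"
  using z_limit[of t] by (simp_all add: mean_square_limit_def)

lemma z_integrable: "integrable M (z t)"
  by (rule M.square_integrable_imp_integrable[OF _ z_square_integrable]) simp

lemma z_expectation: "M.expectation (z t) = 0"
proof -
  have "M.expectation (\<lambda>\<omega>. \<Sum>j<n. frac_diff_coeff d j * x (t - int j) \<omega>) = 0" for n
    by (subst Bochner_Integration.integral_sum) (simp_all add: x_integrable x_expectation)
  then show ?thesis
    using M.mean_square_limit_expectation[OF z_limit[of t]] by (simp add: LIMSEQ_const_iff)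
qed

lemma z_autocovariance:
  assumes "k = 0 \<or> k = 1"
  shows "M.expectation (\<lambda>\<omega>. z t \<omega> * z (t - int k) \<omega>) = gamma_z a b \<sigma> d (real k)"
proof (rule LIMSEQ_unique[OF mean_square_limit_mult[OF z_limit z_limit]])
  let ?p = "frac_diff_coeff d"
  have "M.expectation (\<lambda>\<omega>. (\<Sum>i<n. ?p i * x (t - int i) \<omega>) * (\<Sum>j<n. ?p j * x (t - int k - int j) \<omega>))
      = (\<Sum>i<n. \<Sum>j<n. ?p i * ?p j * csa_autocov a b \<sigma> (int k + (int j - int i)))" for n
  proof -
    have "csa_autocov a b \<sigma> ((t - int k - int j) - (t - int i)) = csa_autocov a b \<sigma> (int k + (int j - int i))" for i j
      using csa_autocov_minus[of a b \<sigma> "int k + (int j - int i)"] by (simp add: algebra_simps)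
    moreover have "(\<Sum>i<n. ?p i * x (t - int i) \<omega>) * (\<Sum>j<n. ?p j * x (t - int k - int j) \<omega>) =
        (\<Sum>i<n. \<Sum>j<n. ?p i * ?p j * (x (t - int i) \<omega> * x (t - int k - int j) \<omega>))" for \<omega>
      unfolding sum_product by (simp add: mult_ac)
    ultimately show ?thesis
      by (simp only: Bochner_Integration.integral_sum Bochner_Integration.integrable_sum
          integrable_mult_right x_mult_integrable integral_mult_right_zero x_autocovariance)
  qed
  then show "(\<lambda>n. M.expectation (\<lambda>\<omega>. (\<Sum>i<n. ?p i * x (t - int i) \<omega>) * (\<Sum>j<n. ?p j * x (t - int k - int j) \<omega>)))
      \<longlonglongrightarrow> gamma_z a b \<sigma> d (real k)"
    using toeplitz_limit[OF assms] by simp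
qed

lemma z_variance: "M.variance (z t) = gamma_z a b \<sigma> d 0"
  using z_autocovariance[of 0 t] by (simp add: z_expectation power2_eq_square)

lemma ar1_error_variance:
  "M.variance (\<lambda>\<omega>. z t \<omega> - c * z (t - 1) \<omega>) =
    gamma_z a b \<sigma> d 0 * (c - gamma_z a b \<sigma> d 1 / gamma_z a b \<sigma> d 0)\<^sup>2 +
    ((gamma_z a b \<sigma> d 0)\<^sup>2 - (gamma_z a b \<sigma> d 1)\<^sup>2) / gamma_z a b \<sigma> d 0"
proof -
  define g0 g1 where "g0 = gamma_z a b \<sigma> d 0" and "g1 = gamma_z a b \<sigma> d 1"
  have "g0 > 0"
    using gamma_z_0_pos by (simp add: g0_def)
  have m: "integrable M (\<lambda>\<omega>. z t \<omega> * z (t - 1) \<omega>)"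
    by (intro square_integrable_mult z_square_integrable) auto
  have mean: "M.expectation (\<lambda>\<omega>. z t \<omega> - c * z (t - 1) \<omega>) = 0"
    by (simp add: z_integrable z_expectation)
  have "M.variance (\<lambda>\<omega>. z t \<omega> - c * z (t - 1) \<omega>) =
      M.expectation (\<lambda>\<omega>. (z t \<omega>)\<^sup>2 - 2 * c * (z t \<omega> * z (t - 1) \<omega>) + c\<^sup>2 * (z (t - 1) \<omega>)\<^sup>2)"
    unfolding mean
    by (intro Bochner_Integration.integral_cong refl) (simp add: power2_diff power_mult_distrib)
  also have "\<dots> = g0 - 2 * c * g1 + c\<^sup>2 * g0"
    using z_square_integrable m z_variance[of t] z_variance[of "t - 1"] z_autocovariance[of 1 t]
    by (simp add: z_expectation g0_def g1_def)
  also have "\<dots> = g0 * (c - g1 / g0)\<^sup>2 + (g0\<^sup>2 - g1\<^sup>2) / g0"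
    using \<open>g0 > 0\<close> by (simp add: power2_eq_square field_simps)
  finally show ?thesis
    by (simp add: g0_def g1_def)
qed

end

theorem theorem5:
  fixes P :: "'a measure" and \<alpha> :: "nat \<Rightarrow> 'a \<Rightarrow> real"
    and \<epsilon> y :: "nat \<Rightarrow> int \<Rightarrow> 'a \<Rightarrow> real"
    and M :: "'b measure" and x z :: "int \<Rightarrow> 'b \<Rightarrow> real"
    and a b d \<sigma> :: real and t :: int
  assumes "a > 0" and "1 < b" and "b < 3" and "b \<noteq> 2"
    and "d = 1 - b / 2"
    and "\<sigma> > 0"
    and "CSA P \<alpha> \<epsilon> y a b \<sigma> M x"
    and "is_frac_diff M d x z"
  shows "prob_space.variance M (z t) = gamma_z a b \<sigma> d 0 \<and>
    (\<forall>\<alpha>\<^sub>I. is_arg_min (\<lambda>c. prob_space.variance M (\<lambda>\<omega>. z t \<omega> - c * z (t - 1) \<omega>)) (\<lambda>_. True) \<alpha>\<^sub>I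
       \<longleftrightarrow> \<alpha>\<^sub>I = gamma_z a b \<sigma> d 1 / gamma_z a b \<sigma> d 0) \<and>
    (\<forall>\<alpha>\<^sub>I. is_arg_min (\<lambda>c. prob_space.variance M (\<lambda>\<omega>. z t \<omega> - c * z (t - 1) \<omega>)) (\<lambda>_. True) \<alpha>\<^sub>I
       \<longrightarrow> prob_space.variance M (\<lambda>\<omega>. z t \<omega> - \<alpha>\<^sub>I * z (t - 1) \<omega>)
             = ((gamma_z a b \<sigma> d 0)\<^sup>2 - (gamma_z a b \<sigma> d 1)\<^sup>2) / gamma_z a b \<sigma> d 0)"
proof -
  have csa: "ar1_panel P \<alpha> \<epsilon> y a b \<sigma>" "prob_space M" "\<And>t. x t \<in> borel_measurable M"
    "fdd_converges P (panel_aggregate y) M x"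
    using assms(7) by (auto simp: CSA_def)
  have "prob_space P"
    using csa(1) by (simp add: ar1_panel_def)
  interpret csa_filtered P \<alpha> \<epsilon> y a b \<sigma> M x d z
    using assms csa \<open>prob_space P\<close>
    by (simp add: csa_filtered_def csa_filtered_axioms_def csa_process_def csa_process_axioms_def
        panel_def panel_axioms_def)
  define g0 g1 where "g0 = gamma_z a b \<sigma> d 0" and "g1 = gamma_z a b \<sigma> d 1"
  have g0: "g0 > 0"
    using gamma_z_0_pos by (simp add: g0_def)
  define V where "V c = prob_space.variance M (\<lambda>\<omega>. z t \<omega> - c * z (t - 1) \<omega>)" for c
  have V: "V c = g0 * (c - g1 / g0)\<^sup>2 + (g0\<^sup>2 - g1\<^sup>2) / g0" for c
    unfolding V_def g0_def g1_def by (rule ar1_error_variance)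
  have min: "is_arg_min V (\<lambda>_. True) c \<longleftrightarrow> c = g1 / g0" for c
  proof
    assume "is_arg_min V (\<lambda>_. True) c"
    then have "V c \<le> V (g1 / g0)"
      by (simp add: is_arg_min_linorder)
    then have "g0 * (c - g1 / g0)\<^sup>2 \<le> 0"
      by (simp add: V)
    then show "c = g1 / g0"
      using g0 by (simp add: mult_le_0_iff)
  next
    assume "c = g1 / g0"
    then show "is_arg_min V (\<lambda>_. True) c"
      using g0 by (simp add: is_arg_min_linorder V)
  qed
  have "V c = (g0\<^sup>2 - g1\<^sup>2) / g0" if "is_arg_min V (\<lambda>_. True) c" for c
    using that unfolding min by (simp add: V)
  with min z_variance[of t] show ?thesis
    unfolding V_def[abs_def] g0_def g1_def by blast
qed

end
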